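(* Let $t,r\ge 2$ be integers and $\varepsilon>0$, and let $G\sim G^{(t)}(n,p)$. There exists $C>0$ (depending only on $t,r,\varepsilon$) such that, if $p\ge Cn^{-t+1}$, then with high probability the following holds. For every $r$-edge-colouring $\chi$ of $G$, there exists an $r$-strip $r$-edge-colouring $\psi$ of $K_n^{(t)}$ such that $$\nu(\chi)\ge\nu(\psi)-\varepsilon n .$$
   Context: $G^{(t)}(n,p)$ is the binomial random $t$-uniform hypergraph on $n$ vertices: each $t$-subset of the vertex set is an edge independently with probability $p=p(n)\in[0,1]$. "With high probability" means with probability tending to $1$ as $n\to\infty$. $K_n^{(t)}$ is the complete $t$-uniform hypergraph on $n$ vertices. An $r$-edge-colouring is a map from the edge set to $[r]$; $\nu(\chi)$ is the maximum size of a monochromatic matching (set of pairwise disjoint edges of one colour) in the colouring $\chi$. An edge-colouring $\psi$ of $K_n^{(t)}$ is an $r$-strip colouring if there is a partition of the vertex set into at most $r$ parts $V_1,\dots,V_r$ (parts may be empty) such that $\psi(e_1)=\psi(e_2)$ whenever $|e_1\cap V_j|=|e_2\cap V_j|$ for every $j\in[r]$. *)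

theory Defs
  imports "HOL-Probability.Probability"
begin

definition complete_hypergraph :: "nat \<Rightarrow> nat \<Rightarrow> nat set set" where
  "complete_hypergraph t n = {e. e \<subseteq> {..<n} \<and> card e = t}"

text \<open>A hypergraph on the vertex set \<open>{..<n}\<close> is represented by its edge set.\<close>

definition random_hypergraph :: "nat \<Rightarrow> nat \<Rightarrow> real \<Rightarrow> nat set set pmf" where
  "random_hypergraph t n p =
     map_pmf (\<lambda>f. {e \<in> complete_hypergraph t n. f e})
       (Pi_pmf (complete_hypergraph t n) False (\<lambda>_. bernoulli_pmf p))"

text \<open>A colouring is a total function of which only the values on the edge set matter.\<close>

definition edge_colouring :: "nat \<Rightarrow> 'a set set \<Rightarrow> ('a set \<Rightarrow> nat) \<Rightarrow> bool" where
  "edge_colouring r E \<phi> \<longleftrightarrow> \<phi> \<in> E \<rightarrow> {1..r}"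

definition monochromatic_matching :: "'a set set \<Rightarrow> ('a set \<Rightarrow> nat) \<Rightarrow> 'a set set \<Rightarrow> bool" where
  "monochromatic_matching E \<phi> M \<longleftrightarrow> M \<subseteq> E \<and> disjoint M \<and> (\<exists>c. \<forall>e\<in>M. \<phi> e = c)"

text \<open>Meaningful for finite \<open>E\<close> only. The empty matching counts, so the value is 0 if \<open>E\<close> is empty.\<close>

definition mono_matching_number :: "'a set set \<Rightarrow> ('a set \<Rightarrow> nat) \<Rightarrow> nat" where
  "mono_matching_number E \<phi> = Max (card ` {M. monochromatic_matching E \<phi> M})"

definition strip_colouring :: "nat \<Rightarrow> nat \<Rightarrow> nat \<Rightarrow> (nat set \<Rightarrow> nat) \<Rightarrow> bool" where
  "strip_colouring r t n \<psi> \<longleftrightarrow>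
     (\<exists>V :: nat \<Rightarrow> nat set.
        disjoint_family_on V {1..r} \<and> (\<Union>j\<in>{1..r}. V j) = {..<n} \<and>
        (\<forall>e\<^sub>1 \<in> complete_hypergraph t n. \<forall>e\<^sub>2 \<in> complete_hypergraph t n.
           (\<forall>j\<in>{1..r}. card (e\<^sub>1 \<inter> V j) = card (e\<^sub>2 \<inter> V j)) \<longrightarrow> \<psi> e\<^sub>1 = \<psi> e\<^sub>2))"

end

theory Submission
  imports Defs
begin

text \<open>The colouring \<open>\<psi>\<close> is built from fractional vertex covers. Suppose
for a moment that the maximum matching of each colour class had the same size as a minimum
fractional vertex cover. Then each vertex gets a weight vector in \<open>[0, 1] ^ r\<close>, one
coordinate for each colour, such that every edge has total weight at least 1 in its own colour,
while in each colour the total weight of all vertices is at most \<open>\<nu> =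
\<nu>(\<chi>)\<close>. Now forget \<open>\<chi>\<close> and colour every \<open>t\<close>-set by a
colour in which its total weight is at least 1: no colour has a matching with more than
\<open>\<nu>\<close> edges, and the colour of an edge depends only on the weight vectors of its
vertices. It remains to reduce to \<open>r\<close> different weight vectors. The largest
coordinate of a convex combination of points in dimension \<open>r\<close> does not need to
increase when one passes to a suitable combination of only \<open>r\<close> of these points
(\<open>caratheodory_max_coordinate\<close>), and vertices can be redistributed accordingly. This
is the origin of the \<open>r\<close> strips
(\<open>strip_colouring_from_covering_weights\<close>).

Two things have to be repaired. A colour class of a sparse hypergraph can have a fractional
matching much larger than any matching. Therefore single edges are replaced by hole-free tuples:
\<open>t\<close> disjoint linear-sized vertex sets such that any choice of not too small subsets
of them is crossed by an edge of the colour in question. A fractional packing of boundedly many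
such tuples can be rounded to a matching (\<open>matching_from_hole_free_tuples\<close>). In the
random hypergraph, with high probability any \<open>t\<close> disjoint sets of linear size are
crossed by an edge (\<open>no_hole_whp\<close>). Consequently any such sets contain a tuple that
is hole-free in one of the colours (\<open>monochromatic_hole_free_subtuple\<close>), so that
weights that cover all hole-free tuples also work for \<open>t\<close>-sets of vertices of
frequent types.

Furthermore the number of weight vectors, and the number of tuples in a packing, have to be
bounded independently of \<open>n\<close>. Both come from an approximate duality proved by the
multiplicative weights argument (\<open>packing_or_covering\<close>): repeatedly add a tuple that
is not covered by weights exponential in the current loads, until either the packing is large or
everything is covered.\<close>

section \<open>Tuples without holes\<close>

definition crossed_by :: "nat \<Rightarrow> (nat \<Rightarrow> 'a set) \<Rightarrow> 'a set set \<Rightarrow> bool" where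
  "crossed_by t X H \<longleftrightarrow> (\<exists>x. (\<forall>j<t. x j \<in> X j) \<and> x ` {..<t} \<in> H)"

text \<open>A tuple is hole-free at scale \<open>h\<close> if the edges cannot avoid any choice of subsets of size
at least \<open>h\<close>. This one-sided remnant of regularity is all that is needed to build matchings
greedily.\<close>

definition hole_free :: "nat \<Rightarrow> 'a set set \<Rightarrow> (nat \<Rightarrow> 'a set) \<Rightarrow> real \<Rightarrow> bool" where
  "hole_free t H A h \<longleftrightarrow>
     (\<forall>X. (\<forall>j<t. X j \<subseteq> A j \<and> h \<le> real (card (X j))) \<longrightarrow> crossed_by t X H)"

lemma hole_free_subsets:
  assumes "hole_free t H A h" "\<And>j. j < t \<Longrightarrow> B j \<subseteq> A j"
  shows "hole_free t H B h"
  using assms unfolding hole_free_def by (meson subset_trans)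

text \<open>A hole of one colour is a place where this colour is absent. Passing to it loses a factor
\<open>\<delta>\<close> in size and removes one colour, so after at most \<open>card S\<close> such steps either some colour
has no hole or there is a tuple crossed by no edge at all, which the hypothesis on \<open>H\<close> excludes.
The sets are trimmed to a common size since every part of a tuple is to lose the same number of
vertices to a matching.\<close>

lemma monochromatic_hole_free_subtuple:
  fixes \<delta> m :: real
  assumes "finite S" "0 < \<delta>" "\<delta> \<le> 1" "0 \<le> m"
    and "\<And>j. j < t \<Longrightarrow> finite (A j) \<and> m \<le> real (card (A j))"
    and "hole_free t H A (\<delta> ^ card S * m)"
    and "\<And>x. (\<forall>j<t. x j \<in> A j) \<Longrightarrow> x ` {..<t} \<in> H \<Longrightarrow> \<phi> (x ` {..<t}) \<in> S"
  shows "\<exists>c\<in>S. \<exists>B b. (\<forall>j<t. B j \<subseteq> A j \<and> card (B j) = b) \<and> \<delta> ^ card S * m \<le> real b \<and>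
           hole_free t {e \<in> H. \<phi> e = c} B (\<delta> * real b)"
  using assms
proof (induction S arbitrary: A m rule: finite_induct)
  case empty
  have "crossed_by t A H"
    using empty.prems(4,5) unfolding hole_free_def by (auto simp del: One_nat_def)
  then show ?case
    using empty.prems(6) unfolding crossed_by_def by blast
next
  case (insert c S)
  define b where "b = nat \<lceil>m\<rceil>"
  have mb: "m \<le> real b"
    unfolding b_def by linarith
  have "\<exists>B. B \<subseteq> A j \<and> card B = b" if "j < t" for j
  proof -
    have "b \<le> card (A j)"
      using insert.prems(4)[OF that] unfolding b_def by linarith
    then show ?thesis
      using insert.prems(4)[OF that] by (meson obtain_subset_with_card_n)
  qed
  then obtain B where B: "\<And>j. j < t \<Longrightarrow> B j \<subseteq> A j \<and> card (B j) = b"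
    by metis
  show ?case
  proof (cases "hole_free t {e \<in> H. \<phi> e = c} B (\<delta> * real b)")
    case True
    have "\<delta> ^ card (insert c S) * m \<le> 1 * m"
      using insert.prems by (intro mult_right_mono power_le_one) auto
    then show ?thesis
      using True B mb by (intro bexI[of _ c] exI[of _ B] exI[of _ b]) auto
  next
    case False
    then obtain X where X: "\<And>j. j < t \<Longrightarrow> X j \<subseteq> B j \<and> \<delta> * real b \<le> real (card (X j))"
      and nc: "\<not> crossed_by t X {e \<in> H. \<phi> e = c}"
      unfolding hole_free_def by blast
    have XA: "X j \<subseteq> A j" if "j < t" for j
      using X B that by blast
    have "\<exists>c\<in>S. \<exists>B b. (\<forall>j<t. B j \<subseteq> X j \<and> card (B j) = b) \<and> \<delta> ^ card S * (\<delta> * m) \<le> real b \<and>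
           hole_free t {e \<in> H. \<phi> e = c} B (\<delta> * real b)"
    proof (rule insert.IH)
      show "0 < \<delta>" "\<delta> \<le> 1" "0 \<le> \<delta> * m"
        using insert.prems by auto
      show "finite (X j) \<and> \<delta> * m \<le> real (card (X j))" if "j < t" for j
      proof -
        have "\<delta> * m \<le> \<delta> * real b"
          using mb insert.prems by (intro mult_left_mono) auto
        then show ?thesis
          using X[OF that] XA[OF that] insert.prems(4)[OF that] finite_subset by fastforce
      qed
      have eq: "\<delta> ^ card S * (\<delta> * m) = \<delta> ^ card (insert c S) * m"
        using insert.hyps by simp
      show "hole_free t H X (\<delta> ^ card S * (\<delta> * m))"
        unfolding eq by (rule hole_free_subsets[OF insert.prems(5) XA])
      show "\<phi> (x ` {..<t}) \<in> S" if x: "\<forall>j<t. x j \<in> X j" "x ` {..<t} \<in> H" for x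
      proof -
        have "\<phi> (x ` {..<t}) \<in> insert c S"
          using x XA by (intro insert.prems(6)) auto
        moreover have "\<phi> (x ` {..<t}) \<noteq> c"
          using nc x unfolding crossed_by_def by blast
        ultimately show ?thesis by simp
      qed
    qed
    then obtain c' B' b' where "c' \<in> S" "\<forall>j<t. B' j \<subseteq> X j \<and> card (B' j) = b'"
      "\<delta> ^ card S * (\<delta> * m) \<le> real b'" "hole_free t {e \<in> H. \<phi> e = c'} B' (\<delta> * real b')"
      by blast
    moreover have "\<delta> ^ card (insert c S) * m = \<delta> ^ card S * (\<delta> * m)"
      using insert.hyps by simp
    moreover have "\<forall>j<t. B' j \<subseteq> A j \<and> card (B' j) = b'"
      using XA calculation(2) by blast
    ultimately show ?thesis
      by (intro bexI[of _ c'] exI[of _ B'] exI[of _ b'] conjI insertI2) (assumption | simp only:)+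
  qed
qed

text \<open>The sets may coincide, which is why each has to be \<open>t\<close> times too large: edges with several
vertices in the same weight class are covered in this way too.\<close>

lemma disjoint_subfamily:
  assumes "\<And>j. j < t \<Longrightarrow> finite (B j) \<and> t * m \<le> card (B j)"
  shows "\<exists>A. disjoint_family_on A {..<t} \<and> (\<forall>j<t. A j \<subseteq> B j \<and> card (A j) = m)"
proof -
  have "\<exists>A. disjoint_family_on A {..<k} \<and> (\<forall>j<k. A j \<subseteq> B j \<and> card (A j) = m)" if "k \<le> t" for k
    using that
  proof (induction k)
    case 0
    then show ?case by (simp add: disjoint_family_on_def)
  next
    case (Suc k)
    have "k \<le> t" using Suc.prems by simp
    from Suc.IH[OF this] obtain A where A: "disjoint_family_on A {..<k}"
      "\<forall>j<k. A j \<subseteq> B j \<and> card (A j) = m"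
      by (elim exE conjE)
    define W where "W = (\<Union>j<k. A j)"
    have "card W \<le> (\<Sum>j<k. card (A j))" unfolding W_def by (intro card_UN_le) simp
    also have "\<dots> = k * m" using A(2) by simp
    finally have "card W \<le> k * m" .
    moreover have fW: "finite W"
    proof -
      have "finite (A j)" if "j < k" for j
        using finite_subset[of "A j" "B j"] A(2) assms[of j] Suc.prems that by simp
      then show ?thesis unfolding W_def by simp
    qed
    moreover have "t * m \<le> card (B k)" using assms[of k] Suc.prems by simp
    moreover have "Suc k * m \<le> t * m" using Suc.prems by (rule mult_le_mono1)
    moreover have "card (B k) - card W \<le> card (B k - W)"
      by (rule diff_card_le_card_Diff[OF fW])
    ultimately have "m \<le> card (B k - W)" by simp
    then obtain Y where Y: "Y \<subseteq> B k - W" "card Y = m" by (meson obtain_subset_with_card_n)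
    have Adisj: "A i \<inter> A j = {}" if "i < k" "j < k" "i \<noteq> j" for i j
      using disjoint_family_onD[OF A(1), of i j] that by simp
    have YA: "Y \<inter> A i = {}" if "i < k" for i using Y(1) that unfolding W_def by blast
    have "disjoint_family_on (A(k := Y)) {..<Suc k}"
      unfolding disjoint_family_on_def
    proof (intro ballI impI)
      fix i j assume ij: "i \<in> {..<Suc k}" "j \<in> {..<Suc k}" "i \<noteq> j"
      then consider "i = k" "j < k" | "j = k" "i < k" | "i < k" "j < k" by fastforce
      then show "(A(k := Y)) i \<inter> (A(k := Y)) j = {}"
        by cases (use YA[of i] YA[of j] Adisj[of i j] ij(3) in \<open>simp_all add: Int_commute\<close>)
    qed
    moreover have "\<forall>j<Suc k. (A(k := Y)) j \<subseteq> B j \<and> card ((A(k := Y)) j) = m"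
      using A(2) Y by (auto simp: less_Suc_eq)
    ultimately show ?case by (intro exI[of _ "A(k := Y)"] conjI)
  qed
  then show ?thesis by blast
qed

section \<open>Matchings from packings of tuples\<close>

text \<open>Greedy extension: a transversal edge uses up one vertex of each part, so as long as the
matching has at most \<open>s - h\<close> edges, at least \<open>h\<close> vertices of each part are still free.\<close>

lemma transversal_matching:
  fixes s h :: real
  assumes t: "t > 0" and disj: "disjoint_family_on A {..<t}"
    and fin: "\<And>j. j < t \<Longrightarrow> finite (A j) \<and> s \<le> real (card (A j))"
    and hf: "hole_free t H A h"
  shows "\<exists>M\<subseteq>H. finite M \<and> disjoint M \<and> (\<forall>e\<in>M. e \<noteq> {} \<and> e \<subseteq> (\<Union>j<t. A j)) \<and> s - h \<le> real (card M)"
proof -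
  define trv where "trv e \<longleftrightarrow> (\<exists>x. (\<forall>j<t. x j \<in> A j) \<and> e = x ` {..<t})" for e
  have step: "\<exists>M\<subseteq>H. finite M \<and> disjoint M \<and> (\<forall>e\<in>M. trv e) \<and> card M = k"
    if "real k < s - h + 1" for k
    using that
  proof (induction k)
    case 0
    show ?case by (intro exI[of _ "{}"]) (auto simp: disjoint_def)
  next
    case (Suc k)
    have "real k < s - h + 1" using Suc.prems by simp
    from Suc.IH[OF this] obtain M where M: "M \<subseteq> H" "finite M" "disjoint M" "card M = k"
      and Mx: "\<forall>e\<in>M. trv e"
      by (elim exE conjE)
    define X where "X j = A j - \<Union>M" for j
    have "crossed_by t X H"
    proof -
      have "X j \<subseteq> A j \<and> h \<le> real (card (X j))" if j: "j < t" for j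
      proof -
        have one: "card (e \<inter> A j) \<le> 1" if "e \<in> M" for e
        proof -
          have "trv e" using Mx that by (rule bspec)
          then obtain x where x: "\<forall>j<t. x j \<in> A j" "e = x ` {..<t}"
            unfolding trv_def by (elim exE conjE)
          have "e \<inter> A j \<subseteq> {x j}"
          proof
            fix y assume "y \<in> e \<inter> A j"
            then obtain i where i: "i < t" "y = x i" "y \<in> A j"
              using x by auto
            then have "i = j"
              using disjoint_family_onD[OF disj, of i j] x(1) j by auto
            then show "y \<in> {x j}" using i by simp
          qed
          then show ?thesis
            using card_mono[of "{x j}" "e \<inter> A j"] by simp
        qed
        have "card (A j \<inter> \<Union>M) \<le> (\<Sum>e\<in>M. card (e \<inter> A j))"
        proof -
          have "A j \<inter> \<Union>M = (\<Union>e\<in>M. e \<inter> A j)" by auto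
          then show ?thesis using card_UN_le[OF M(2), of "\<lambda>e. e \<inter> A j"] by simp
        qed
        also have "\<dots> \<le> k"
          using sum_mono[of M "\<lambda>e. card (e \<inter> A j)" "\<lambda>_. 1"] one M(4) by simp
        finally have "card (A j \<inter> \<Union>M) \<le> k" .
        moreover have "card (X j) = card (A j) - card (A j \<inter> \<Union>M)"
          unfolding X_def using fin[OF j] by (simp add: card_Diff_subset_Int)
        ultimately have "real (card (A j)) - real k \<le> real (card (X j))"
          by linarith
        then show ?thesis
          using fin[OF j] Suc.prems unfolding X_def by auto
      qed
      then show ?thesis using hf unfolding hole_free_def by blast
    qed
    then obtain x where x: "\<forall>j<t. x j \<in> X j" "x ` {..<t} \<in> H"
      unfolding crossed_by_def by blast
    define e where "e = x ` {..<t}"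
    have eM: "e \<inter> \<Union>M = {}"
      using x(1) unfolding e_def X_def by auto
    have "e \<noteq> {}" using t unfolding e_def by auto
    then have "e \<notin> M" using eM by auto
    then have "card (insert e M) = Suc k" using M by simp
    moreover have "disjoint (insert e M)"
      using M(3) eM unfolding disjoint_def by blast
    moreover have "\<forall>e\<in>insert e M. trv e"
    proof -
      have "trv e"
        unfolding trv_def e_def using x(1) by (intro exI[of _ x]) (simp add: X_def)
      then show ?thesis using Mx by simp
    qed
    ultimately show ?case
      using M x(2) by (intro exI[of _ "insert e M"]) (auto simp: e_def)
  qed
  have "real (nat \<lceil>s - h\<rceil>) < s - h + 1 \<or> s - h \<le> 0" by linarith
  then consider "real (nat \<lceil>s - h\<rceil>) < s - h + 1" | "s - h \<le> 0" by blast
  then show ?thesis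
  proof cases
    case 1
    obtain M where M: "M \<subseteq> H" "finite M" "disjoint M" "card M = nat \<lceil>s - h\<rceil>"
      and Mx: "\<forall>e\<in>M. trv e"
      using step[OF 1] by (elim exE conjE)
    have "s - h \<le> real (card M)" unfolding M(4) by linarith
    moreover have "\<forall>e\<in>M. e \<noteq> {} \<and> e \<subseteq> (\<Union>j<t. A j)"
    proof
      fix e assume "e \<in> M"
      with Mx have "trv e" by (rule bspec)
      then obtain x where "\<forall>j<t. x j \<in> A j" "e = x ` {..<t}"
        unfolding trv_def by (elim exE conjE)
      then show "e \<noteq> {} \<and> e \<subseteq> (\<Union>j<t. A j)" using t by auto
    qed
    ultimately show ?thesis using M by blast
  next
    case 2
    then show ?thesis by (intro exI[of _ "{}"]) (auto simp: disjoint_def)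
  qed
qed

text \<open>Deterministic substitute for a random splitting of the vertex set into \<open>L\<close> equal parts that
cuts every fibre of \<open>g\<close> evenly.\<close>

lemma balanced_labelling:
  assumes "finite V" "L > 0"
  obtains h :: "'a \<Rightarrow> nat" where
    "\<And>y l. l < L \<Longrightarrow> card {v\<in>V. g v = y} \<le> L * (card {v\<in>V. g v = y \<and> h v = l} + 1)"
proof -
  have "\<exists>f. bij_betw f {v\<in>V. g v = y} {0..<card {v\<in>V. g v = y}}" for y
    using assms(1) by (intro ex_bij_betw_finite_nat) auto
  then obtain f where f: "\<And>y. bij_betw (f y) {v\<in>V. g v = y} {0..<card {v\<in>V. g v = y}}"
    by metis
  define h where "h v = f (g v) v mod L" for v
  show ?thesis
  proof
    fix y l assume l: "l < L"
    define m where "m = card {v\<in>V. g v = y}"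
    have "{0..<m div L} \<subseteq> (\<lambda>v. f y v div L) ` {v\<in>V. g v = y \<and> h v = l}"
    proof
      fix q assume "q \<in> {0..<m div L}"
      then have "Suc q \<le> m div L" by simp
      then have "Suc q * L \<le> m"
        using l by (metis less_eq_div_iff_mult_less_eq gr_implies_not0 neq0_conv)
      then have "q * L + l < m" using l by simp
      then have "q * L + l \<in> f y ` {v\<in>V. g v = y}"
        using f[of y] unfolding bij_betw_def m_def by auto
      then obtain v where "v \<in> V" "g v = y" "f y v = q * L + l" by auto
      then show "q \<in> (\<lambda>v. f y v div L) ` {v\<in>V. g v = y \<and> h v = l}"
        using l unfolding h_def by (intro image_eqI[of _ _ v]) auto
    qed
    then have "card {0..<m div L} \<le> card {v\<in>V. g v = y \<and> h v = l}"
      using assms(1) by (intro surj_card_le) auto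
    then have "m div L \<le> card {v\<in>V. g v = y \<and> h v = l}" by simp
    moreover have "m \<le> L * (m div L + 1)"
      using assms(2) by (metis Suc_eq_plus1 dividend_less_times_div less_imp_le mult_Suc_right)
    ultimately show "card {v\<in>V. g v = y} \<le> L * (card {v\<in>V. g v = y \<and> h v = l} + 1)"
      unfolding m_def by (meson add_le_mono1 le_trans mult_le_mono2)
  qed
qed

text \<open>Rounding of a fractional packing of tuples. If a vertex lies in at most \<open>L\<close> of the tuples, its
label among \<open>L\<close> labels decides for which of them it is used: for the one whose rank, among the
tuples containing the vertex, equals the label. The tuples then share the vertices, and as the
labelling is balanced on every atom of the set system, each part keeps a proportion \<open>1 / L\<close> of
its vertices up to one vertex per atom; there are at most \<open>2 ^ (M * t)\<close> atoms. Since
hole-freeness passes to subsets, the greedy matching works within the shares.\<close>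

lemma matching_from_hole_free_tuples:
  fixes A :: "nat \<Rightarrow> nat \<Rightarrow> 'a set" and b :: "nat \<Rightarrow> nat" and \<delta> :: real
  assumes "finite V" "t > 0" "L > 0"
    and A: "\<And>i j. i < M \<Longrightarrow> j < t \<Longrightarrow> A i j \<subseteq> V \<and> card (A i j) = b i"
    and disj: "\<And>i. i < M \<Longrightarrow> disjoint_family_on (A i) {..<t}"
    and hf: "\<And>i. i < M \<Longrightarrow> hole_free t H (A i) (\<delta> * real (b i))"
    and load: "\<And>v. v \<in> V \<Longrightarrow> card {i. i < M \<and> v \<in> (\<Union>j<t. A i j)} \<le> L"
  shows "\<exists>Q\<subseteq>H. finite Q \<and> disjoint Q \<and>
           (\<Sum>i<M. real (b i)) * (1 / real L - \<delta>) - real (M * 2 ^ (M * t)) \<le> real (card Q)"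
proof -
  define g where "g v = {(i, j). i < M \<and> j < t \<and> v \<in> A i j}" for v
  define rank where "rank i v = card {i'. i' < i \<and> v \<in> (\<Union>j<t. A i' j)}" for i v
  obtain h :: "'a \<Rightarrow> nat" where h: "\<And>y l. l < L \<Longrightarrow>
      card {v\<in>V. g v = y} \<le> L * (card {v\<in>V. g v = y \<and> h v = l} + 1)"
    using balanced_labelling[OF assms(1,3)] by blast
  define B where "B i j = {v \<in> A i j. h v = rank i v}" for i j
  have fA: "finite (A i j)" if "i < M" "j < t" for i j
    using A[OF that] assms(1) finite_subset by blast
  have rank_less: "rank i v < L" if "i < M" "j < t" "v \<in> A i j" for i j v
  proof -
    have "{i'. i' < i \<and> v \<in> (\<Union>j<t. A i' j)} \<subset> {i'. i' < M \<and> v \<in> (\<Union>j<t. A i' j)}"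
      using that by auto
    then have "rank i v < card {i'. i' < M \<and> v \<in> (\<Union>j<t. A i' j)}"
      unfolding rank_def by (intro psubset_card_mono) auto
    also have "\<dots> \<le> L" using load A that by blast
    finally show ?thesis .
  qed
  have atoms: "card (g ` W) \<le> 2 ^ (M * t)" for W
  proof -
    have "g ` W \<subseteq> Pow ({..<M} \<times> {..<t})" unfolding g_def by auto
    then have "card (g ` W) \<le> card (Pow ({..<M} \<times> {..<t}))" by (intro card_mono) auto
    then show ?thesis by (simp add: card_Pow card_cartesian_product)
  qed
  have share: "real (b i) / real L - 2 ^ (M * t) \<le> real (card (B i j))" if ij: "i < M" "j < t" for i j
  proof -
    have fib: "card {v \<in> A i j. g v = y} \<le> L * (card {v \<in> B i j. g v = y} + 1)"
      if y: "y \<in> g ` A i j" for y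
    proof -
      obtain u where u: "u \<in> A i j" "y = g u" using y by auto
      have same: "v \<in> V \<and> g v = y \<longleftrightarrow> v \<in> A i j \<and> g v = y" for v
      proof
        assume v: "v \<in> V \<and> g v = y"
        have "(i, j) \<in> g u" using u ij unfolding g_def by simp
        then have "(i, j) \<in> g v" using v u by simp
        then have "v \<in> A i j" unfolding g_def by simp
        then show "v \<in> A i j \<and> g v = y" using v by simp
      qed (use A[OF ij] in auto)
      have rk: "rank i v = rank i u" if "g v = y" for v
      proof -
        have "(i', j') \<in> g v \<longleftrightarrow> (i', j') \<in> g u" for i' j'
          using that u by simp
        then have "v \<in> A i' j' \<longleftrightarrow> u \<in> A i' j'" if "i' < M" "j' < t" for i' j'
          using that unfolding g_def mem_Collect_eq case_prod_conv by blast
        then have "{i'. i' < i \<and> v \<in> (\<Union>j<t. A i' j)} = {i'. i' < i \<and> u \<in> (\<Union>j<t. A i' j)}"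
          using ij by auto
        then show ?thesis unfolding rank_def by simp
      qed
      have "{v\<in>V. g v = y} = {v \<in> A i j. g v = y}" using same by blast
      moreover have "v \<in> V \<and> g v = y \<and> h v = rank i u \<longleftrightarrow> v \<in> B i j \<and> g v = y" for v
        using same[of v] rk[of v] unfolding B_def mem_Collect_eq by (cases "g v = y") auto
      then have "{v\<in>V. g v = y \<and> h v = rank i u} = {v \<in> B i j. g v = y}"
        by (simp only:)
      ultimately show ?thesis
        using h[OF rank_less[OF ij u(1)], of y] by simp
    qed
    have part: "card W = (\<Sum>y\<in>g ` A i j. card {v\<in>W. g v = y})" if "W \<subseteq> A i j" for W
    proof -
      have "W = (\<Union>y\<in>g ` A i j. {v\<in>W. g v = y})" using that by auto
      moreover have "card (\<Union>y\<in>g ` A i j. {v\<in>W. g v = y}) = (\<Sum>y\<in>g ` A i j. card {v\<in>W. g v = y})"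
        using fA[OF ij] that finite_subset[OF that] by (intro card_UN_disjoint) auto
      ultimately show ?thesis by simp
    qed
    have "b i = (\<Sum>y\<in>g ` A i j. card {v \<in> A i j. g v = y})"
      using part[of "A i j"] A[OF ij] by simp
    also have "\<dots> \<le> (\<Sum>y\<in>g ` A i j. L * (card {v \<in> B i j. g v = y} + 1))"
      by (intro sum_mono fib)
    also have "\<dots> = L * (card (B i j) + card (g ` A i j))"
      using part[of "B i j"] unfolding B_def
      by (simp add: sum.distrib sum_distrib_left[symmetric] algebra_simps)
    also have "\<dots> \<le> L * (card (B i j) + 2 ^ (M * t))"
      using atoms by simp
    finally have "real (b i) \<le> real (L * (card (B i j) + 2 ^ (M * t)))"
      using of_nat_le_iff by blast
    then have "real (b i) \<le> (real (card (B i j)) + 2 ^ (M * t)) * real L"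
      by (simp add: mult.commute)
    moreover have "0 < real L" using assms(3) by simp
    ultimately have "real (b i) / real L \<le> real (card (B i j)) + 2 ^ (M * t)"
      by (simp only: pos_divide_le_eq)
    then show ?thesis by linarith
  qed
  have "\<exists>Q\<subseteq>H. finite Q \<and> disjoint Q \<and> (\<forall>e\<in>Q. e \<noteq> {} \<and> e \<subseteq> (\<Union>j<t. B i j)) \<and>
      (real (b i) / real L - 2 ^ (M * t)) - \<delta> * real (b i) \<le> real (card Q)" if i: "i < M" for i
  proof (rule transversal_matching[OF assms(2)])
    show "disjoint_family_on (B i) {..<t}"
      using disj[OF i] unfolding B_def disjoint_family_on_def by blast
    show "finite (B i j) \<and> real (b i) / real L - 2 ^ (M * t) \<le> real (card (B i j))" if "j < t" for j
      using share[OF i that] fA[OF i that] unfolding B_def by auto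
    show "hole_free t H (B i) (\<delta> * real (b i))"
      by (rule hole_free_subsets[OF hf[OF i]]) (auto simp: B_def)
  qed
  then obtain Q where Q: "\<And>i. i < M \<Longrightarrow> Q i \<subseteq> H" "\<And>i. i < M \<Longrightarrow> finite (Q i)"
    "\<And>i. i < M \<Longrightarrow> disjoint (Q i)"
    "\<And>i e. i < M \<Longrightarrow> e \<in> Q i \<Longrightarrow> e \<noteq> {} \<and> e \<subseteq> (\<Union>j<t. B i j)"
    "\<And>i. i < M \<Longrightarrow> (real (b i) / real L - 2 ^ (M * t)) - \<delta> * real (b i) \<le> real (card (Q i))"
    by metis
  have Bdisj: "(\<Union>j<t. B i j) \<inter> (\<Union>j<t. B i' j) = {}" if "i < i'" for i i'
  proof (rule ccontr)
    assume "\<not> ?thesis"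
    then obtain v j j' where v: "j < t" "j' < t" "v \<in> B i j" "v \<in> B i' j'" by auto
    have "{k. k < i \<and> v \<in> (\<Union>j<t. A k j)} \<subset> {k. k < i' \<and> v \<in> (\<Union>j<t. A k j)}"
      using v that unfolding B_def by auto
    then have "rank i v < rank i' v" unfolding rank_def by (intro psubset_card_mono) auto
    then show False using v unfolding B_def by auto
  qed
  have edges_disj: "e \<inter> e' = {}" if "i < M" "i' < M" "i \<noteq> i'" "e \<in> Q i" "e' \<in> Q i'" for i i' e e'
  proof -
    have "(\<Union>j<t. B i j) \<inter> (\<Union>j<t. B i' j) = {}"
      using Bdisj[of i i'] Bdisj[of i' i] that(3) by (cases i i' rule: linorder_cases) (simp_all only: inf_commute)
    moreover have "e \<subseteq> (\<Union>j<t. B i j)" "e' \<subseteq> (\<Union>j<t. B i' j)"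
      using Q(4)[OF that(1,4)] Q(4)[OF that(2,5)] by simp_all
    ultimately show ?thesis
      by (metis Int_mono subset_empty)
  qed
  define R where "R = (\<Union>i<M. Q i)"
  have "Q i \<inter> Q i' = {}" if "i < M" "i' < M" "i \<noteq> i'" for i i'
  proof (rule equals0I)
    fix e assume e: "e \<in> Q i \<inter> Q i'"
    then have "e \<inter> e = {}" using edges_disj[OF that, of e e] by simp
    then show False using Q(4)[OF that(1), of e] e by simp
  qed
  then have "card R = (\<Sum>i<M. card (Q i))"
    unfolding R_def using Q(2) by (intro card_UN_disjoint) simp_all
  moreover have "(\<Sum>i<M. real (b i) * (1 / real L - \<delta>) - 2 ^ (M * t)) \<le> (\<Sum>i<M. real (card (Q i)))"
    using Q(5) by (intro sum_mono) (simp add: algebra_simps)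
  ultimately have "(\<Sum>i<M. real (b i)) * (1 / real L - \<delta>) - real (M * 2 ^ (M * t)) \<le> real (card R)"
    by (simp add: sum_subtractf sum_distrib_right)
  moreover have "disjoint R"
    unfolding disjoint_def
  proof (intro ballI impI)
    fix e e' assume "e \<in> R" "e' \<in> R" "e \<noteq> e'"
    then obtain i i' where "i < M" "i' < M" "e \<in> Q i" "e' \<in> Q i'" unfolding R_def by auto
    then show "e \<inter> e' = {}"
      using edges_disj[of i i' e e'] Q(3)[of i] \<open>e \<noteq> e'\<close> unfolding disjoint_def by (cases "i = i'") auto
  qed
  moreover have "R \<subseteq> H" unfolding R_def using Q(1) by (simp add: UN_subset_iff)
  moreover have "finite R" unfolding R_def using Q(2) by simp
  ultimately show ?thesis by (intro exI[of _ R] conjI)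
qed

section \<open>Packing and covering by exponential weights\<close>

definition load :: "nat \<Rightarrow> (nat \<Rightarrow> 'a set) list \<Rightarrow> 'a \<Rightarrow> nat" where
  "load t As v = length (filter (\<lambda>A. v \<in> (\<Union>j<t. A j)) As)"

lemma load_Cons: "load t (A # As) v = load t As v + of_bool (v \<in> (\<Union>j<t. A j))"
  unfolding load_def by auto

text \<open>An approximate form of linear programming duality between packing the tuples in \<open>P\<close> into \<open>V\<close>
and covering them by vertex weights of total value \<open>\<kappa> * card V\<close>, in which the dual solution takes
at most \<open>L + 1\<close> different values, whatever the size of \<open>V\<close>. This boundedness is the reason for not
using an exact optimum.

The weights are exponential in the load: \<open>v\<close> receives \<open>\<kappa> * n * (1 + \<eta>) ^ load v / D\<close>, where \<open>D\<close> is
the sum of the powers. A list of tuples is extended by a tuple that its weights do not cover. By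
the failure to cover, such a step multiplies \<open>D\<close> by at most \<open>1 + \<eta> * b / (\<kappa> * n)\<close>, where \<open>b\<close> is the size
of the parts, so that \<open>D\<close> stays below \<open>n * exp (\<eta> * S / (\<kappa> * n))\<close> for the total size \<open>S\<close>. If \<open>D\<close>
reaches \<open>\<kappa> * n * (1 + \<eta>) ^ L\<close>, this bound makes \<open>S\<close> large, which is the first alternative. Before
that, an uncovered tuple that lies in level sets of the load has all its weights below 1, hence
all its loads below \<open>L\<close>, and so the loads never exceed \<open>L\<close>. The loads also bound the length of
the list, and a longest list that has not reached the threshold gives the second alternative.\<close>

lemma packing_or_covering:
  fixes P :: "(nat \<Rightarrow> 'a set) \<Rightarrow> bool" and \<eta> \<kappa> d :: real
  assumes V: "finite V" "V \<noteq> {}" and t: "t > 0" and pos: "\<eta> > 0" "\<kappa> > 0" "d > 0"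
    and PV: "\<And>A j. P A \<Longrightarrow> j < t \<Longrightarrow> A j \<subseteq> V \<and> card (A j) = card (A 0)"
    and Pd: "\<And>A. P A \<Longrightarrow> disjoint_family_on A {..<t} \<and> d \<le> real (card (A 0))"
  shows "(\<exists>As. (\<forall>A\<in>set As. P A) \<and> (\<forall>v\<in>V. load t As v \<le> L) \<and>
            (\<kappa> * card V / \<eta>) * (real L * ln (1 + \<eta>) + ln \<kappa>) \<le> (\<Sum>A\<leftarrow>As. real (card (A 0))) \<and>
            (\<Sum>A\<leftarrow>As. real (card (A 0))) \<le> real L * card V) \<or>
         (\<exists>l \<omega>. (\<forall>v\<in>V. l v \<le> L) \<and> (\<forall>k::nat. 0 \<le> \<omega> k) \<and> (\<Sum>v\<in>V. \<omega> (l v)) = \<kappa> * real (card V) \<and>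
            (\<forall>A. P A \<longrightarrow> (\<forall>j<t. \<forall>u\<in>A j. \<forall>v\<in>A j. l u = l v) \<longrightarrow>
               real (card (A 0)) \<le> (\<Sum>j<t. \<Sum>v\<in>A j. \<omega> (l v))))"
proof -
  define n where "n = real (card V)"
  have n: "n > 0" unfolding n_def using V by (simp add: card_gt_0_iff)
  define S where "S As = (\<Sum>A\<leftarrow>As. real (card (A 0)))" for As :: "(nat \<Rightarrow> 'a set) list"
  define D where "D As = (\<Sum>v\<in>V. (1 + \<eta>) ^ load t As v)" for As
  define good where "good As \<longleftrightarrow> (\<forall>A\<in>set As. P A) \<and> (\<forall>v\<in>V. load t As v \<le> L) \<and>
      D As \<le> n * exp (\<eta> * S As / (\<kappa> * n))" for As
  have Dpos: "D As > 0" for As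
    unfolding D_def using V pos by (intro sum_pos) auto
  have union_sum: "(\<Sum>v\<in>(\<Union>j<t. A j). F v) = (\<Sum>j<t. \<Sum>v\<in>A j. F v)" if "P A" for A and F :: "'a \<Rightarrow> real"
    using PV[OF that] Pd[OF that] finite_subset[OF _ V(1)]
    by (intro sum.UNION_disjoint) (auto simp: disjoint_family_on_def)
  have union_V: "(\<Union>j<t. A j) \<subseteq> V" if "P A" for A using PV[OF that] by auto
  have S_le: "S As \<le> (\<Sum>v\<in>V. real (load t As v))" if "\<forall>A\<in>set As. P A" for As
    using that
  proof (induction As)
    case Nil
    then show ?case by (simp add: S_def load_def)
  next
    case (Cons A As)
    have "real (card (A 0)) \<le> (\<Sum>v\<in>(\<Union>j<t. A j). (1::real))"
    proof -
      have "A 0 \<subseteq> (\<Union>j<t. A j)" using t by auto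
      then have "card (A 0) \<le> card (\<Union>j<t. A j)"
        using Cons.prems union_V finite_subset[OF _ V(1)] by (intro card_mono) auto
      then show ?thesis by simp
    qed
    also have "\<dots> = (\<Sum>v\<in>V. real (of_bool (v \<in> (\<Union>j<t. A j))))"
      using Cons.prems union_V V(1) by (intro sum.mono_neutral_cong_left) auto
    finally show ?case
      using Cons by (simp add: load_Cons S_def sum.distrib)
  qed
  have S_L: "S As \<le> real L * n" if "good As" for As
  proof -
    have "S As \<le> (\<Sum>v\<in>V. real (load t As v))" using that unfolding good_def by (intro S_le) auto
    also have "\<dots> \<le> (\<Sum>v\<in>V. real L)" using that unfolding good_def by (intro sum_mono) auto
    finally show ?thesis by (simp add: n_def mult.commute)
  qed
  have len: "length As \<le> nat \<lceil>real L * n / d\<rceil>" if "good As" for As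
  proof -
    have "real (length As) * d \<le> S As" if "\<forall>A\<in>set As. P A"
      using that unfolding S_def
      by (induction As) (use Pd in \<open>auto simp: algebra_simps intro: add_mono\<close>)
    then have "real (length As) * d \<le> S As" using that unfolding good_def by blast
    then have "real (length As) * d \<le> real L * n" using S_L[OF that] by linarith
    then have "real (length As) \<le> real L * n / d" using pos by (simp add: pos_le_divide_eq)
    then show ?thesis by linarith
  qed
  have "good []"
    unfolding good_def using pos n by (simp add: D_def S_def load_def n_def)
  then have "\<exists>As. good As \<and> (\<forall>Bs. good Bs \<longrightarrow> length Bs \<le> length As)"
    using ex_has_greatest_nat[of good "[]" length "Suc (nat \<lceil>real L * n / d\<rceil>)"] len
    by (metis less_Suc_eq_le)
  then obtain As where As: "good As" "\<And>Bs. good Bs \<Longrightarrow> length Bs \<le> length As" by blast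
  show ?thesis
  proof (cases "\<kappa> * n * (1 + \<eta>) ^ L \<le> D As")
    case True
    have "\<kappa> * (1 + \<eta>) ^ L * n \<le> exp (\<eta> * S As / (\<kappa> * n)) * n"
      using True As(1) unfolding good_def by (simp add: mult_ac)
    then have "\<kappa> * (1 + \<eta>) ^ L \<le> exp (\<eta> * S As / (\<kappa> * n))"
      using n by simp
    then have "ln (\<kappa> * (1 + \<eta>) ^ L) \<le> ln (exp (\<eta> * S As / (\<kappa> * n)))"
      using pos by (subst ln_le_cancel_iff) auto
    then have "ln \<kappa> + real L * ln (1 + \<eta>) \<le> \<eta> * S As / (\<kappa> * n)"
      using pos by (simp add: ln_mult ln_realpow)
    then have "(\<kappa> * n / \<eta>) * (ln \<kappa> + real L * ln (1 + \<eta>)) \<le> (\<kappa> * n / \<eta>) * (\<eta> * S As / (\<kappa> * n))"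
      using pos n by (intro mult_left_mono) auto
    also have "\<dots> = S As" using pos n by simp
    finally have "(\<kappa> * n / \<eta>) * (real L * ln (1 + \<eta>) + ln \<kappa>) \<le> S As" by (simp add: add.commute)
    then have "\<exists>As. (\<forall>A\<in>set As. P A) \<and> (\<forall>v\<in>V. load t As v \<le> L) \<and>
            (\<kappa> * card V / \<eta>) * (real L * ln (1 + \<eta>) + ln \<kappa>) \<le> (\<Sum>A\<leftarrow>As. real (card (A 0))) \<and>
            (\<Sum>A\<leftarrow>As. real (card (A 0))) \<le> real L * card V"
      using As(1) S_L[OF As(1)] unfolding good_def n_def S_def by blast
    then show ?thesis ..
  next
    case False
    define \<omega> where "\<omega> k = \<kappa> * n * (1 + \<eta>) ^ k / D As" for k :: nat
    have w0: "0 \<le> \<omega> k" for k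
      unfolding \<omega>_def using pos n Dpos[of As] by simp
    have "(\<Sum>v\<in>V. \<omega> (load t As v)) = \<kappa> * n * D As / D As"
      unfolding \<omega>_def D_def by (simp add: sum_distrib_left sum_divide_distrib)
    then have wV: "(\<Sum>v\<in>V. \<omega> (load t As v)) = \<kappa> * real (card V)"
      using Dpos[of As] unfolding n_def by simp
    have cover: "real (card (A 0)) \<le> (\<Sum>j<t. \<Sum>v\<in>A j. \<omega> (load t As v))"
      if A: "P A" and const: "\<forall>j<t. \<forall>u\<in>A j. \<forall>v\<in>A j. load t As u = load t As v" for A
    proof (rule ccontr)
      assume nc: "\<not> ?thesis"
      \<comment> \<open>Otherwise \<open>A\<close> could be added to the list of maximal length.\<close>
      define T where "T = (\<Union>j<t. A j)"
      have small: "load t As u < L" if u: "u \<in> T" for u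
      proof -
        obtain j where j: "j < t" "u \<in> A j" using u unfolding T_def by auto
        have "real (card (A 0)) * \<omega> (load t As u) = (\<Sum>v\<in>A j. \<omega> (load t As u))"
          using PV[OF A j(1)] by simp
        also have "\<dots> = (\<Sum>v\<in>A j. \<omega> (load t As v))"
        proof (rule sum.cong)
          fix v assume "v \<in> A j"
          then have "load t As u = load t As v" using const j by blast
          then show "\<omega> (load t As u) = \<omega> (load t As v)" by simp
        qed simp
        also have "\<dots> \<le> (\<Sum>j<t. \<Sum>v\<in>A j. \<omega> (load t As v))"
          using j w0 by (intro member_le_sum) (auto intro: sum_nonneg)
        also have "\<dots> < real (card (A 0)) * 1" using nc by simp
        finally have "real (card (A 0)) * \<omega> (load t As u) < real (card (A 0)) * 1" .
        moreover have "0 < real (card (A 0))" using Pd[OF A] pos by linarith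
        ultimately have "\<omega> (load t As u) < 1" by (simp only: mult_less_cancel_left_pos)
        then have "\<kappa> * n * (1 + \<eta>) ^ load t As u < D As"
          unfolding \<omega>_def using Dpos[of As] by simp
        also have "\<dots> < \<kappa> * n * (1 + \<eta>) ^ L" using False by simp
        finally have "(1 + \<eta>) ^ load t As u < (1 + \<eta>) ^ L" using pos n by simp
        then show ?thesis using pos by (simp add: power_strict_increasing_iff)
      qed
      have D_Cons: "D (A # As) = D As + \<eta> * (\<Sum>v\<in>T. (1 + \<eta>) ^ load t As v)"
      proof -
        have "D (A # As) = (\<Sum>v\<in>V. (1 + \<eta>) ^ load t As v + of_bool (v \<in> T) * (\<eta> * (1 + \<eta>) ^ load t As v))"
          unfolding D_def T_def by (intro sum.cong) (auto simp: load_Cons algebra_simps)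
        also have "\<dots> = D As + (\<Sum>v\<in>V. of_bool (v \<in> T) * (\<eta> * (1 + \<eta>) ^ load t As v))"
          unfolding D_def by (rule sum.distrib)
        also have "(\<Sum>v\<in>V. of_bool (v \<in> T) * (\<eta> * (1 + \<eta>) ^ load t As v))
            = (\<Sum>v\<in>T. \<eta> * (1 + \<eta>) ^ load t As v)"
          using union_V[OF A] V(1) unfolding T_def by (intro sum.mono_neutral_cong_right) auto
        finally show ?thesis by (simp add: sum_distrib_left)
      qed
      have "(\<Sum>v\<in>T. \<omega> (load t As v)) = \<kappa> * n / D As * (\<Sum>v\<in>T. (1 + \<eta>) ^ load t As v)"
        unfolding \<omega>_def by (simp add: sum_distrib_left)
      then have "\<kappa> * n / D As * (\<Sum>v\<in>T. (1 + \<eta>) ^ load t As v) < real (card (A 0))"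
        using nc union_sum[OF A, of "\<lambda>v. \<omega> (load t As v)"] unfolding T_def by simp
      then have T_le: "(\<Sum>v\<in>T. (1 + \<eta>) ^ load t As v) \<le> D As * (real (card (A 0)) / (\<kappa> * n))"
        using Dpos[of As] pos n by (simp add: field_simps)
      have "D (A # As) \<le> D As + \<eta> * (D As * (real (card (A 0)) / (\<kappa> * n)))"
        unfolding D_Cons using pos(1) by (intro add_left_mono mult_left_mono T_le) simp
      also have "\<dots> = D As * (1 + \<eta> * real (card (A 0)) / (\<kappa> * n))"
        by (simp add: algebra_simps)
      also have "\<dots> \<le> D As * exp (\<eta> * real (card (A 0)) / (\<kappa> * n))"
        using Dpos[of As] by (intro mult_left_mono exp_ge_add_one_self) auto
      also have "\<dots> \<le> n * exp (\<eta> * S As / (\<kappa> * n)) * exp (\<eta> * real (card (A 0)) / (\<kappa> * n))"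
        using As(1) unfolding good_def by (intro mult_right_mono) auto
      also have "\<dots> = n * exp (\<eta> * S (A # As) / (\<kappa> * n))"
        unfolding S_def by (simp add: mult_exp_exp algebra_simps add_divide_distrib)
      finally have "D (A # As) \<le> n * exp (\<eta> * S (A # As) / (\<kappa> * n))" .
      moreover have "\<forall>v\<in>V. load t (A # As) v \<le> L"
        using As(1) small unfolding good_def T_def by (auto simp: load_Cons Suc_le_eq)
      ultimately have "good (A # As)" using As(1) A unfolding good_def by auto
      then have "length (A # As) \<le> length As" by (rule As(2))
      then show False by simp
    qed
    have "\<exists>l \<omega>. (\<forall>v\<in>V. l v \<le> L) \<and> (\<forall>k::nat. 0 \<le> \<omega> k) \<and> (\<Sum>v\<in>V. \<omega> (l v)) = \<kappa> * real (card V) \<and>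
            (\<forall>A. P A \<longrightarrow> (\<forall>j<t. \<forall>u\<in>A j. \<forall>v\<in>A j. l u = l v) \<longrightarrow>
               real (card (A 0)) \<le> (\<Sum>j<t. \<Sum>v\<in>A j. \<omega> (l v)))"
    proof (intro exI[of _ "load t As"] exI[of _ \<omega>] conjI)
      show "\<forall>v\<in>V. load t As v \<le> L" using As(1) unfolding good_def by simp
      show "\<forall>k. 0 \<le> \<omega> k" using w0 by simp
      show "(\<Sum>v\<in>V. \<omega> (load t As v)) = \<kappa> * real (card V)" by (rule wV)
    qed (rule allI, rule impI, rule impI, rule cover, assumption+)
    then show ?thesis ..
  qed
qed

text \<open>Only tuples inside the level sets of \<open>l\<close> are considered: for them, if \<open>b > 0\<close>, the
inequality says that the values of \<open>\<omega>\<close> on the \<open>t\<close> levels add up to at least 1.\<close>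

definition covers_level_tuples ::
    "nat \<Rightarrow> 'a set \<Rightarrow> 'a set set \<Rightarrow> real \<Rightarrow> real \<Rightarrow> ('a \<Rightarrow> nat) \<Rightarrow> (nat \<Rightarrow> real) \<Rightarrow> bool" where
  "covers_level_tuples t V H d \<delta> l \<omega> \<longleftrightarrow>
     (\<forall>A b. (\<forall>j<t. A j \<subseteq> V \<and> card (A j) = b) \<longrightarrow> disjoint_family_on A {..<t} \<longrightarrow>
        d \<le> real b \<longrightarrow> hole_free t H A (\<delta> * real b) \<longrightarrow>
        (\<forall>j<t. \<forall>u\<in>A j. \<forall>v\<in>A j. l u = l v) \<longrightarrow> real b \<le> (\<Sum>j<t. \<Sum>v\<in>A j. \<omega> (l v)))"

text \<open>If the matchings of one colour are small, the packing alternative is impossible, because rounding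
it would give too large a matching; so there is a cheap fractional cover. The losses in the bound
on \<open>k\<close> come from \<open>ln (1 + \<eta>) \<ge> \<eta> - \<eta>\<^sup>2\<close>, from the initial value of the exponential potential, from
the vertices left over in each tuple, and from the atoms in the rounding.\<close>

lemma fractional_cover_of_hole_free_tuples:
  fixes \<eta> \<kappa> \<delta> \<theta> k :: real
  assumes V: "finite V" "V \<noteq> {}" and t: "t > 0" and L: "L > 0"
    and \<eta>: "0 < \<eta>" "\<eta> \<le> 1" and \<kappa>: "0 < \<kappa>" "\<kappa> \<le> 2" and \<delta>: "0 < \<delta>" and \<theta>: "0 < \<theta>"
    and matching: "\<And>Q. Q \<subseteq> H \<Longrightarrow> finite Q \<Longrightarrow> disjoint Q \<Longrightarrow> real (card Q) \<le> k"
    and N: "real L / \<theta> \<le> real N"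
    and k: "k < (\<kappa> - 2 * \<eta> - 1 / (\<eta> * L) - \<delta> * L) * card V - real (N * 2 ^ (N * t))"
  shows "\<exists>l \<omega>. (\<forall>v\<in>V. l v \<le> L) \<and> (\<forall>k::nat. 0 \<le> \<omega> k) \<and> (\<Sum>v\<in>V. \<omega> (l v)) = \<kappa> * real (card V) \<and>
      covers_level_tuples t V H (\<theta> * real (card V)) \<delta> l \<omega>"
proof -
  define n where "n = real (card V)"
  have n: "n > 0" unfolding n_def using V by (simp add: card_gt_0_iff)
  define P where "P A \<longleftrightarrow> (\<forall>j<t. A j \<subseteq> V \<and> card (A j) = card (A 0)) \<and> disjoint_family_on A {..<t} \<and>
      \<theta> * n \<le> real (card (A 0)) \<and> hole_free t H A (\<delta> * real (card (A 0)))" for A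
  have "(\<exists>As. (\<forall>A\<in>set As. P A) \<and> (\<forall>v\<in>V. load t As v \<le> L) \<and>
            (\<kappa> * card V / \<eta>) * (real L * ln (1 + \<eta>) + ln \<kappa>) \<le> (\<Sum>A\<leftarrow>As. real (card (A 0))) \<and>
            (\<Sum>A\<leftarrow>As. real (card (A 0))) \<le> real L * card V) \<or>
         (\<exists>l \<omega>. (\<forall>v\<in>V. l v \<le> L) \<and> (\<forall>k::nat. 0 \<le> \<omega> k) \<and> (\<Sum>v\<in>V. \<omega> (l v)) = \<kappa> * real (card V) \<and>
            (\<forall>A. P A \<longrightarrow> (\<forall>j<t. \<forall>u\<in>A j. \<forall>v\<in>A j. l u = l v) \<longrightarrow>
               real (card (A 0)) \<le> (\<Sum>j<t. \<Sum>v\<in>A j. \<omega> (l v))))"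
  proof (rule packing_or_covering[OF V t \<eta>(1) \<kappa>(1)])
    show "0 < \<theta> * n" using n \<theta> by simp
    show "\<And>A j. P A \<Longrightarrow> j < t \<Longrightarrow> A j \<subseteq> V \<and> card (A j) = card (A 0)" unfolding P_def by blast
    show "\<And>A. P A \<Longrightarrow> disjoint_family_on A {..<t} \<and> \<theta> * n \<le> real (card (A 0))" unfolding P_def by blast
  qed
  then show ?thesis
  proof (elim disjE exE conjE)
    fix As
    assume P: "\<forall>A\<in>set As. P A" and load: "\<forall>v\<in>V. load t As v \<le> L"
      and S_ge: "(\<kappa> * card V / \<eta>) * (real L * ln (1 + \<eta>) + ln \<kappa>) \<le> (\<Sum>A\<leftarrow>As. real (card (A 0)))"
      and S_le: "(\<Sum>A\<leftarrow>As. real (card (A 0))) \<le> real L * card V"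
    define M where "M = length As"
    define b where "b i = card ((As ! i) 0)" for i
    define S where "S = (\<Sum>i<M. real (b i))"
    have S: "(\<Sum>A\<leftarrow>As. real (card (A 0))) = S"
      unfolding S_def M_def b_def by (simp add: sum_list_sum_nth atLeast0LessThan)
    have Pi: "P (As ! i)" if "i < M" for i using P that unfolding M_def by simp
    have "\<exists>Q\<subseteq>H. finite Q \<and> disjoint Q \<and> S * (1 / real L - \<delta>) - real (M * 2 ^ (M * t)) \<le> real (card Q)"
      unfolding S_def
    proof (rule matching_from_hole_free_tuples[OF V(1) t L, of M "\<lambda>i. As ! i"])
      show "(As ! i) j \<subseteq> V \<and> card ((As ! i) j) = b i" if "i < M" "j < t" for i j
        using Pi[OF that(1)] that(2) unfolding P_def b_def by blast
      show "disjoint_family_on (As ! i) {..<t}" "hole_free t H (As ! i) (\<delta> * real (b i))" if "i < M" for i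
        using Pi[OF that] unfolding P_def b_def by blast+
      show "card {i. i < M \<and> v \<in> (\<Union>j<t. (As ! i) j)} \<le> L" if "v \<in> V" for v
        using bspec[OF load that] unfolding load_def length_filter_conv_card M_def .
    qed
    then obtain Q where Q: "Q \<subseteq> H" "finite Q" "disjoint Q"
      "S * (1 / real L - \<delta>) - real (M * 2 ^ (M * t)) \<le> real (card Q)"
      by (elim exE conjE)
    have "real M * (\<theta> * n) \<le> S"
    proof -
      have "(\<Sum>i<M. \<theta> * n) \<le> S"
        unfolding S_def using Pi by (intro sum_mono) (auto simp: P_def b_def)
      then show ?thesis by simp
    qed
    then have "real M * \<theta> * n \<le> real L * n" using S_le unfolding S n_def by (simp add: mult_ac)
    then have "real M * \<theta> \<le> real L" using n by simp
    then have "real M \<le> real L / \<theta>" using \<theta> by (simp add: pos_le_divide_eq)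
    then have MN: "M \<le> N" using N by linarith
    then have "M * 2 ^ (M * t) \<le> N * 2 ^ (N * t)"
      by (intro mult_le_mono power_increasing) auto
    then have err: "real (M * 2 ^ (M * t)) \<le> real (N * 2 ^ (N * t))" by (simp only: of_nat_le_iff)
    have "ln (1 / \<kappa>) \<le> 1 / \<kappa> - 1" using \<kappa> by (intro ln_le_minus_one) simp
    then have "1 - 1 / \<kappa> \<le> ln \<kappa>" using \<kappa> by (simp add: ln_div)
    then have "\<kappa> * (1 - 1 / \<kappa>) \<le> \<kappa> * ln \<kappa>" using \<kappa> by (intro mult_left_mono) auto
    then have lnk: "- 1 \<le> \<kappa> * ln \<kappa>" using \<kappa> by (simp add: right_diff_distrib)
    have ln1: "\<eta> - \<eta>\<^sup>2 \<le> ln (1 + \<eta>)" using \<eta> by (intro ln_one_plus_pos_lower_bound) auto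
    have "\<kappa> - 2 * \<eta> \<le> \<kappa> * (1 - \<eta>)" using \<kappa>(2) \<eta> by (simp add: right_diff_distrib mult_right_mono)
    also have "\<dots> = \<kappa> / \<eta> * (\<eta> - \<eta>\<^sup>2)" using \<eta> by (simp add: field_simps power2_eq_square)
    also have "\<dots> \<le> \<kappa> / \<eta> * ln (1 + \<eta>)" using ln1 \<kappa> \<eta> by (intro mult_left_mono) auto
    finally have main: "\<kappa> - 2 * \<eta> \<le> \<kappa> / \<eta> * ln (1 + \<eta>)" .
    have "- 1 / (\<eta> * L) \<le> \<kappa> * ln \<kappa> / (\<eta> * L)" using lnk \<eta> L by (intro divide_right_mono) auto
    with main have "\<kappa> - 2 * \<eta> - 1 / (\<eta> * L) \<le> \<kappa> / \<eta> * ln (1 + \<eta>) + \<kappa> * ln \<kappa> / (\<eta> * L)" by simp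
    also have "\<dots> = \<kappa> / \<eta> * (real L * ln (1 + \<eta>) + ln \<kappa>) / L"
      using L \<eta> by (simp add: field_simps)
    finally have "(\<kappa> - 2 * \<eta> - 1 / (\<eta> * L)) * n \<le> \<kappa> / \<eta> * (real L * ln (1 + \<eta>) + ln \<kappa>) / L * n"
      using n by (intro mult_right_mono) auto
    also have "\<dots> = (\<kappa> * card V / \<eta>) * (real L * ln (1 + \<eta>) + ln \<kappa>) / L" unfolding n_def by simp
    also have "\<dots> \<le> S / L" using S_ge L unfolding S by (intro divide_right_mono) auto
    finally have gain: "(\<kappa> - 2 * \<eta> - 1 / (\<eta> * L)) * n \<le> S / L" .
    have "\<delta> * S \<le> \<delta> * (real L * n)" using S_le \<delta> unfolding S n_def by (intro mult_left_mono) auto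
    with gain have "(\<kappa> - 2 * \<eta> - 1 / (\<eta> * L) - \<delta> * L) * n \<le> S * (1 / real L - \<delta>)"
      by (simp add: algebra_simps)
    then have "k < real (card Q)" using k err Q(4) unfolding n_def by linarith
    with matching[OF Q(1-3)] have False by linarith
    then show ?thesis ..
  next
    fix l and \<omega> :: "nat \<Rightarrow> real"
    assume lw: "\<forall>v\<in>V. l v \<le> L" "\<forall>k. 0 \<le> \<omega> k" "(\<Sum>v\<in>V. \<omega> (l v)) = \<kappa> * real (card V)"
      and cover: "\<forall>A. P A \<longrightarrow> (\<forall>j<t. \<forall>u\<in>A j. \<forall>v\<in>A j. l u = l v) \<longrightarrow>
               real (card (A 0)) \<le> (\<Sum>j<t. \<Sum>v\<in>A j. \<omega> (l v))"
    have tuples: "real b \<le> (\<Sum>j<t. \<Sum>v\<in>A j. \<omega> (l v))"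
      if "\<forall>j<t. A j \<subseteq> V \<and> card (A j) = b" "disjoint_family_on A {..<t}"
         "\<theta> * real (card V) \<le> real b" "hole_free t H A (\<delta> * real b)"
         "\<forall>j<t. \<forall>u\<in>A j. \<forall>v\<in>A j. l u = l v" for A b
    proof -
      have b: "card (A 0) = b" using that(1) t by simp
      have "P A" unfolding P_def b n_def using that by simp
      with cover have "(\<forall>j<t. \<forall>u\<in>A j. \<forall>v\<in>A j. l u = l v) \<longrightarrow>
          real (card (A 0)) \<le> (\<Sum>j<t. \<Sum>v\<in>A j. \<omega> (l v))"
        by (elim allE[of _ A]) (rule mp)
      from mp[OF this that(5)] show ?thesis unfolding b .
    qed
    show ?thesis
      by (rule exI[of _ l], rule exI[of _ \<omega>], intro conjI lw, unfold covers_level_tuples_def,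
          intro allI impI, rule tuples)
  qed
qed

section \<open>Convex combinations with few points\<close>

text \<open>Elimination of one unknown for each equation.\<close>

lemma underdetermined_homogeneous_system:
  fixes a :: "'e \<Rightarrow> 'i \<Rightarrow> real"
  assumes "finite E" "finite I" "card E < card I"
  shows "\<exists>x. (\<exists>i\<in>I. x i \<noteq> 0) \<and> (\<forall>e\<in>E. (\<Sum>i\<in>I. a e i * x i) = 0)"
  using assms
proof (induction E arbitrary: I a rule: finite_induct)
  case empty
  then obtain i where "i \<in> I" by (metis card_gt_0_iff card.empty equals0I)
  then show ?case by (intro exI[of _ "\<lambda>_. 1"]) auto
next
  case (insert e E)
  show ?case
  proof (cases "\<forall>i\<in>I. a e i = 0")
    case True
    obtain x where "\<exists>i\<in>I. x i \<noteq> 0" "\<forall>e\<in>E. (\<Sum>i\<in>I. a e i * x i) = 0"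
      using insert.IH[of I a] insert.prems insert.hyps by auto
    then show ?thesis using True by (intro exI[of _ x]) auto
  next
    case False
    then obtain p where p: "p \<in> I" "a e p \<noteq> 0" by blast
    define J where "J = I - {p}"
    have J: "finite J" "p \<notin> J" "I = insert p J" and "card E < card J"
      using insert.prems insert.hyps p unfolding J_def by auto
    then obtain x where x: "\<exists>i\<in>J. x i \<noteq> 0"
      "\<forall>f\<in>E. (\<Sum>i\<in>J. (a f i - a f p * a e i / a e p) * x i) = 0"
      using insert.IH[of J "\<lambda>f i. a f i - a f p * a e i / a e p"] by auto
    define z where "z = - (\<Sum>i\<in>J. a e i * x i) / a e p"
    have sum: "(\<Sum>i\<in>I. a f i * (x(p := z)) i) = a f p * z + (\<Sum>i\<in>J. a f i * x i)" for f
    proof -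
      have "(\<Sum>i\<in>J. a f i * (x(p := z)) i) = (\<Sum>i\<in>J. a f i * x i)"
        using J by (intro sum.cong) auto
      then show ?thesis using J by simp
    qed
    have zero: "(\<Sum>i\<in>I. a f i * (x(p := z)) i) = 0" if "f \<in> insert e E" for f
    proof (cases "f = e")
      case True
      then have "a f p * z + (\<Sum>i\<in>J. a f i * x i) = 0" unfolding z_def using p by simp
      then show ?thesis by (simp only: sum)
    next
      case False
      then have "(\<Sum>i\<in>J. (a f i - a f p * a e i / a e p) * x i) = 0"
        using x that by auto
      moreover have "(\<Sum>i\<in>J. (a f i - a f p * a e i / a e p) * x i)
          = (\<Sum>i\<in>J. a f i * x i) - a f p / a e p * (\<Sum>i\<in>J. a e i * x i)"
        by (simp add: sum_distrib_left sum_subtractf[symmetric] algebra_simps)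
      ultimately have "a f p * z + (\<Sum>i\<in>J. a f i * x i) = 0"
        unfolding z_def by (simp add: algebra_simps)
      then show ?thesis by (simp only: sum)
    qed
    have "\<exists>i\<in>I. (x(p := z)) i \<noteq> 0"
      using x(1) J by (metis fun_upd_other insertI2)
    then show ?thesis by (intro exI[of _ "x(p := z)"] conjI ballI zero)
  qed
qed

text \<open>A minimiser of the largest coordinate over a convex hull in dimension \<open>card C\<close> lies on the
boundary, which is why \<open>card C\<close> points suffice instead of the \<open>card C + 1\<close> of Caratheodory's
theorem. Concretely, a convex combination of more points can be moved in a direction that keeps
the total mass and changes all coordinates by one common amount: with that amount as a further
unknown there are \<open>card C + 1\<close> equations in at least \<open>card C + 2\<close> unknowns. Up to the sign the
change does not increase any coordinate, and one moves until a coefficient vanishes.\<close>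

lemma caratheodory_max_coordinate:
  fixes a :: "'i \<Rightarrow> real" and w :: "'i \<Rightarrow> 'c \<Rightarrow> real"
  assumes "finite U" "finite C" "\<And>u. u \<in> U \<Longrightarrow> 0 \<le> a u" "(\<Sum>u\<in>U. a u) = 1"
    and "\<And>c. c \<in> C \<Longrightarrow> (\<Sum>u\<in>U. a u * w u c) \<le> K" and "C \<noteq> {}"
  shows "\<exists>J b. J \<subseteq> U \<and> card J \<le> card C \<and> (\<forall>u\<in>J. 0 \<le> b u) \<and> (\<Sum>u\<in>J. b u) = 1 \<and>
           (\<forall>c\<in>C. (\<Sum>u\<in>J. b u * w u c) \<le> K)"
  using assms
proof (induction "card U" arbitrary: U a rule: less_induct)
  case less
  show ?case
  proof (cases "card U \<le> card C")
    case True
    then show ?thesis using less.prems by blast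
  next
    case False
    have fU: "finite U" by fact
    \<comment> \<open>The unknowns \<open>Some u\<close> are the direction, and \<open>None\<close> is the common change of the coordinates;
      the equation \<open>None\<close> keeps the total mass.\<close>
    define I where "I = insert None (Some ` U)"
    define A where "A e i = (case e of None \<Rightarrow> (case i of None \<Rightarrow> 0 | Some u \<Rightarrow> 1)
        | Some c \<Rightarrow> (case i of None \<Rightarrow> -1 | Some u \<Rightarrow> w u c))" for e i
    have cI: "card I = card U + 1" and fI: "finite I"
      unfolding I_def using fU by (auto simp: card_image)
    have sumI: "(\<Sum>i\<in>I. F i) = F None + (\<Sum>u\<in>U. F (Some u))" for F :: "'i option \<Rightarrow> real"
      unfolding I_def using fU by (simp add: sum.reindex)
    have "card (insert None (Some ` C)) < card I"
      unfolding cI using less.prems(2) False by (simp add: card_image)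
    then obtain x where x: "\<exists>i\<in>I. x i \<noteq> 0"
      "\<forall>e\<in>insert None (Some ` C). (\<Sum>i\<in>I. A e i * x i) = 0"
      using underdetermined_homogeneous_system[of "insert None (Some ` C)" I A] fI less.prems(2) by auto
    define sg :: real where "sg = (if x None \<le> 0 then 1 else -1)"
    define y where "y u = sg * x (Some u)" for u
    have sy: "(\<Sum>u\<in>U. y u) = 0"
      using x(2) unfolding y_def by (simp add: sumI A_def sum_distrib_left[symmetric])
    have wy: "(\<Sum>u\<in>U. y u * w u c) \<le> 0" if "c \<in> C" for c
    proof -
      have "(\<Sum>u\<in>U. w u c * x (Some u)) = x None"
        using x(2) that by (simp add: sumI A_def)
      then have "(\<Sum>u\<in>U. y u * w u c) = sg * x None"
        unfolding y_def by (simp add: sum_distrib_left[symmetric] mult_ac)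
      then show ?thesis unfolding sg_def by auto
    qed
    have "\<exists>u\<in>U. y u \<noteq> 0"
    proof (rule ccontr)
      assume "\<not> ?thesis"
      then have xs: "\<forall>u\<in>U. x (Some u) = 0" unfolding y_def sg_def by (auto split: if_splits)
      then have "x None \<noteq> 0" using x(1) unfolding I_def by auto
      obtain c where "c \<in> C" using less.prems(6) by blast
      then have "x None = 0" using x(2) xs by (auto simp add: sumI A_def)
      then show False using \<open>x None \<noteq> 0\<close> by simp
    qed
    then obtain u0 where "u0 \<in> U" "y u0 < 0"
    proof -
      have "\<exists>u\<in>U. y u < 0"
      proof (rule ccontr)
        assume "\<not> ?thesis"
        then have "\<forall>u\<in>U. y u = 0"
          using sy sum_nonneg_eq_0_iff[OF fU, of y] by (simp add: not_less)
        then show False using \<open>\<exists>u\<in>U. y u \<noteq> 0\<close> by blast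
      qed
      then show ?thesis using that by blast
    qed
    define N where "N = {u\<in>U. y u < 0}"
    have N: "finite N" "N \<noteq> {}"
      using fU \<open>u0 \<in> U\<close> \<open>y u0 < 0\<close> unfolding N_def by auto
    define s where "s = Min ((\<lambda>u. a u / - y u) ` N)"
    obtain p where p: "p \<in> N" "s = a p / - y p"
      using Min_in[of "(\<lambda>u. a u / - y u) ` N"] N unfolding s_def by blast
    have sle: "s \<le> a u / - y u" if "u \<in> N" for u
      using that N unfolding s_def by auto
    have s0: "s \<ge> 0" using p less.prems(3) unfolding N_def by (auto intro: divide_nonneg_neg)
    define a' where "a' u = a u + s * y u" for u
    have "a' p = 0" using p unfolding a'_def N_def by simp
    have a'0: "0 \<le> a' u" if "u \<in> U" for u
    proof (cases "y u < 0")
      case True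
      then have "s * (- y u) \<le> a u"
        using sle[of u] that pos_le_divide_eq[of "- y u" s "a u"] unfolding N_def by auto
      then show ?thesis unfolding a'_def by simp
    next
      case False
      then show ?thesis unfolding a'_def using s0 less.prems(3)[OF that] by simp
    qed
    define U' where "U' = U - {p}"
    have pU: "p \<in> U" using p unfolding N_def by auto
    have drop: "(\<Sum>u\<in>U'. a' u * F u) = (\<Sum>u\<in>U. a' u * F u)" for F
      unfolding U'_def using fU pU \<open>a' p = 0\<close> by (simp add: sum_diff1)
    have "\<exists>J b. J \<subseteq> U' \<and> card J \<le> card C \<and> (\<forall>u\<in>J. 0 \<le> b u) \<and> (\<Sum>u\<in>J. b u) = 1 \<and>
           (\<forall>c\<in>C. (\<Sum>u\<in>J. b u * w u c) \<le> K)"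
    proof (rule less.hyps)
      show "card U' < card U" unfolding U'_def using fU pU by (rule card_Diff1_less)
      show "finite U'" "finite C" using fU less.prems(2) unfolding U'_def by auto
      show "\<And>u. u \<in> U' \<Longrightarrow> 0 \<le> a' u" using a'0 unfolding U'_def by auto
      have "(\<Sum>u\<in>U. a' u) = (\<Sum>u\<in>U. a u) + s * (\<Sum>u\<in>U. y u)"
        unfolding a'_def by (simp add: sum.distrib sum_distrib_left)
      then show "(\<Sum>u\<in>U'. a' u) = 1"
        using drop[of "\<lambda>_. 1"] less.prems(4) sy by simp
      fix c assume c: "c \<in> C"
      have "(\<Sum>u\<in>U. a' u * w u c) = (\<Sum>u\<in>U. a u * w u c) + s * (\<Sum>u\<in>U. y u * w u c)"
        unfolding a'_def by (simp add: sum.distrib sum_distrib_left algebra_simps)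
      also have "\<dots> \<le> K"
        using less.prems(5)[OF c] mult_nonneg_nonpos[OF s0 wy[OF c]] by linarith
      finally show "(\<Sum>u\<in>U'. a' u * w u c) \<le> K" using drop[of "\<lambda>u. w u c"] by simp
    next
      show "C \<noteq> {}" by fact
    qed
    then obtain J b where Jb: "J \<subseteq> U' \<and> card J \<le> card C \<and> (\<forall>u\<in>J. 0 \<le> b u) \<and> (\<Sum>u\<in>J. b u) = 1 \<and>
           (\<forall>c\<in>C. (\<Sum>u\<in>J. b u * w u c) \<le> K)"
      by (elim exE)
    moreover have "J \<subseteq> U" using Jb unfolding U'_def by blast
    ultimately show ?thesis by (intro exI[of _ J] exI[of _ b]) simp
  qed
qed

lemma assignment_with_capacities:
  fixes m :: "'i \<Rightarrow> nat"
  assumes "finite J" "finite V" "card V \<le> (\<Sum>u\<in>J. m u)"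
  shows "\<exists>f. f ` V \<subseteq> J \<and> (\<forall>u\<in>J. card {v\<in>V. f v = u} \<le> m u)"
  using assms
proof (induction J arbitrary: V rule: finite_induct)
  case empty
  then have "V = {}" by simp
  then show ?case by simp
next
  case (insert j J)
  obtain X where X: "X \<subseteq> V" "card X = min (m j) (card V)"
    by (rule obtain_subset_with_card_n[of "min (m j) (card V)" V]) auto
  have fX: "finite X" using X insert.prems finite_subset by blast
  have "card (V - X) \<le> (\<Sum>u\<in>J. m u)"
    using insert X by (simp add: card_Diff_subset[OF fX X(1)])
  then obtain f where f: "f ` (V - X) \<subseteq> J" "\<And>u. u \<in> J \<Longrightarrow> card {v\<in>V - X. f v = u} \<le> m u"
    using insert.IH[of "V - X"] insert.prems by auto
  define g where "g v = (if v \<in> X then j else f v)" for v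
  have "{v\<in>V. g v = j} = X"
    using f(1) X(1) insert.hyps unfolding g_def by auto
  moreover have "{v\<in>V. g v = u} = {v\<in>V - X. f v = u}" if "u \<in> J" for u
    using that insert.hyps unfolding g_def by auto
  ultimately have "\<forall>u\<in>insert j J. card {v\<in>V. g v = u} \<le> m u"
    using X f(2) by auto
  moreover have "g ` V \<subseteq> insert j J" using f(1) unfolding g_def by auto
  ultimately show ?case by blast
qed

section \<open>Strip colourings from covering weights\<close>

lemma finite_monochromatic_matchings:
  assumes "finite E"
  shows "finite {M. monochromatic_matching E \<phi> M}"
  by (rule finite_subset[of _ "Pow E"]) (use assms in \<open>auto simp: monochromatic_matching_def\<close>)

lemma card_le_mono_matching_number:
  assumes "finite E" "monochromatic_matching E \<phi> M"
  shows "card M \<le> mono_matching_number E \<phi>"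
  unfolding mono_matching_number_def
  using finite_monochromatic_matchings[OF assms(1)] assms(2) by (intro Max_ge) auto

lemma mono_matching_number_attained:
  assumes "finite E"
  obtains M where "monochromatic_matching E \<phi> M" "card M = mono_matching_number E \<phi>"
proof -
  have "monochromatic_matching E \<phi> {}"
    unfolding monochromatic_matching_def disjoint_def by simp
  then have "Max (card ` {M. monochromatic_matching E \<phi> M}) \<in> card ` {M. monochromatic_matching E \<phi> M}"
    using finite_monochromatic_matchings[OF assms] by (intro Max_in) auto
  then show thesis
    using that unfolding mono_matching_number_def by auto
qed

lemma finite_complete_hypergraph: "finite (complete_hypergraph t n)"
  unfolding complete_hypergraph_def by (rule finite_subset[of _ "Pow {..<n}"]) auto

lemma sum_by_fibres:
  fixes F :: "'i \<Rightarrow> real"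
  assumes "finite S" "finite J" "f ` S \<subseteq> J"
  shows "(\<Sum>v\<in>S. F (f v)) = (\<Sum>u\<in>J. real (card {v\<in>S. f v = u}) * F u)"
proof -
  have "(\<Sum>v\<in>S. F (f v)) = (\<Sum>u\<in>J. \<Sum>v\<in>{v\<in>S. f v = u}. F (f v))"
    using sum.group[OF assms, of "\<lambda>v. F (f v)"] by simp
  also have "\<dots> = (\<Sum>u\<in>J. real (card {v\<in>S. f v = u}) * F u)"
    by (intro sum.cong) auto
  finally show ?thesis .
qed

text \<open>The step from covering weights to strips. The weight vectors in \<open>U\<close> play the role of vertex types,
with \<open>a\<close> their distribution. After reducing to at most \<open>r\<close> types, each type becomes one strip, and
an edge is given a colour whose weights sum to at least 1 on it. This depends only on the numbers
of its vertices in the strips. The edges of a matching of colour \<open>c\<close> are disjoint and each has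
weight at least 1 in colour \<open>c\<close>, so their number is at most the total weight. The term \<open>r\<close> is due to
rounding the sizes of the strips.\<close>

lemma strip_colouring_from_covering_weights:
  fixes a :: "'i \<Rightarrow> real" and w :: "'i \<Rightarrow> nat \<Rightarrow> real"
  assumes "r \<ge> 1" "finite U" and a: "\<And>u. u \<in> U \<Longrightarrow> 0 \<le> a u" "(\<Sum>u\<in>U. a u) = 1"
    and w: "\<And>u c. u \<in> U \<Longrightarrow> 0 \<le> w u c \<and> w u c \<le> 1"
    and K: "\<And>c. c \<in> {1..r} \<Longrightarrow> (\<Sum>u\<in>U. a u * w u c) \<le> K"
    and cover: "\<And>u. (\<forall>j<t. u j \<in> U) \<Longrightarrow> \<exists>c\<in>{1..r}. 1 \<le> (\<Sum>j<t. w (u j) c)"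
  shows "\<exists>\<psi>. edge_colouring r (complete_hypergraph t n) \<psi> \<and> strip_colouring r t n \<psi> \<and>
           real (mono_matching_number (complete_hypergraph t n) \<psi>) \<le> K * real n + real r"
proof -
  have "\<exists>J b. J \<subseteq> U \<and> card J \<le> card {1..r} \<and> (\<forall>u\<in>J. 0 \<le> b u) \<and> (\<Sum>u\<in>J. b u) = 1 \<and>
           (\<forall>c\<in>{1..r}. (\<Sum>u\<in>J. b u * w u c) \<le> K)"
    by (rule caratheodory_max_coordinate[OF assms(2) _ a K]) (use assms(1) in simp_all)
  then obtain J b where J: "J \<subseteq> U" "card J \<le> card {1..r}"
    and b: "\<forall>u\<in>J. 0 \<le> b u" "(\<Sum>u\<in>J. b u) = 1"
    and bK: "\<forall>c\<in>{1..r}. (\<Sum>u\<in>J. b u * w u c) \<le> K"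
    by (elim exE conjE)
  have fJ: "finite J" using J assms(2) finite_subset by blast
  define m where "m u = nat \<lceil>b u * real n\<rceil>" for u
  have m: "b u * real n \<le> real (m u)" "u \<in> J \<Longrightarrow> real (m u) \<le> b u * real n + 1" for u
  proof -
    show "b u * real n \<le> real (m u)" unfolding m_def by linarith
    assume "u \<in> J"
    then have "0 \<le> b u * real n" using b by simp
    then show "real (m u) \<le> b u * real n + 1" unfolding m_def by linarith
  qed
  have "real n = (\<Sum>u\<in>J. b u * real n)"
    using b(2) by (simp add: sum_distrib_right[symmetric])
  also have "\<dots> \<le> (\<Sum>u\<in>J. real (m u))" using m(1) by (intro sum_mono)
  finally have "real n \<le> real (\<Sum>u\<in>J. m u)" by simp
  then have "card {..<n} \<le> (\<Sum>u\<in>J. m u)"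
    by (simp only: of_nat_le_iff card_lessThan)
  then obtain f where f: "f ` {..<n} \<subseteq> J" "\<And>u. u \<in> J \<Longrightarrow> card {v\<in>{..<n}. f v = u} \<le> m u"
    using assignment_with_capacities[OF fJ, of "{..<n}" m] by auto
  obtain \<rho> where \<rho>: "inj_on \<rho> J" "\<rho> ` J \<subseteq> {1..r}"
    using card_le_inj[OF fJ, of "{1..r}"] J(2) by auto
  define V where "V i = {v. v < n \<and> \<rho> (f v) = i}" for i
  define wt where "wt e c = (\<Sum>u\<in>J. real (card (e \<inter> V (\<rho> u))) * w u c)" for e c
  define \<psi> where "\<psi> e = (SOME c. c \<in> {1..r} \<and> 1 \<le> wt e c)" for e
  have wt: "wt e c = (\<Sum>v\<in>e. w (f v) c)" if "e \<subseteq> {..<n}" for e c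
  proof -
    have "e \<inter> V (\<rho> u) = {v\<in>e. f v = u}" if "u \<in> J" for u
      using \<rho>(1) f(1) \<open>e \<subseteq> {..<n}\<close> that unfolding V_def inj_on_def by auto
    then have wte: "wt e c = (\<Sum>u\<in>J. real (card {v\<in>e. f v = u}) * w u c)"
      unfolding wt_def by (intro sum.cong) auto
    show ?thesis
    proof -
      have "finite e" using that finite_subset by blast
      moreover have "f ` e \<subseteq> J" using f(1) that by blast
      ultimately have "(\<Sum>v\<in>e. w (f v) c) = (\<Sum>u\<in>J. real (card {v\<in>e. f v = u}) * w u c)"
        by (rule sum_by_fibres[OF _ fJ, of e f "\<lambda>u. w u c"])
      then show ?thesis using wte by simp
    qed
  qed
  have \<psi>: "\<psi> e \<in> {1..r} \<and> 1 \<le> wt e (\<psi> e)" if e: "e \<in> complete_hypergraph t n" for e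
  proof -
    have en: "e \<subseteq> {..<n}" and ct: "card e = t" using e unfolding complete_hypergraph_def by auto
    then obtain x where x: "bij_betw x {..<t} e"
      using ex_bij_betw_nat_finite[OF finite_subset[OF en]] unfolding atLeast0LessThan by auto
    have "\<forall>j<t. f (x j) \<in> U"
      using x en f(1) J(1) unfolding bij_betw_def by blast
    from cover[OF this] obtain c where c: "c \<in> {1..r}" "1 \<le> (\<Sum>j<t. w (f (x j)) c)"
      by (elim bexE)
    have "(\<Sum>j<t. w (f (x j)) c) = wt e c"
      unfolding wt[OF en] using sum.reindex_bij_betw[OF x, of "\<lambda>v. w (f v) c"] by simp
    then have "\<exists>c. c \<in> {1..r} \<and> 1 \<le> wt e c" using c by auto
    then show ?thesis unfolding \<psi>_def by (rule someI_ex)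
  qed
  have colouring: "edge_colouring r (complete_hypergraph t n) \<psi>"
    unfolding edge_colouring_def using \<psi> by blast
  have strip: "strip_colouring r t n \<psi>"
    unfolding strip_colouring_def
  proof (intro exI[of _ V] conjI ballI impI)
    show "disjoint_family_on V {1..r}" unfolding disjoint_family_on_def V_def by auto
    show "(\<Union>j\<in>{1..r}. V j) = {..<n}" using f(1) \<rho>(2) unfolding V_def by auto
    fix e e' assume "\<forall>j\<in>{1..r}. card (e \<inter> V j) = card (e' \<inter> V j)"
    then have "wt e c = wt e' c" for c
      unfolding wt_def using \<rho>(2) by (intro sum.cong) auto
    then show "\<psi> e = \<psi> e'" unfolding \<psi>_def by simp
  qed
  obtain M where M: "monochromatic_matching (complete_hypergraph t n) \<psi> M"
    and cM: "card M = mono_matching_number (complete_hypergraph t n) \<psi>"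
    using mono_matching_number_attained[OF finite_complete_hypergraph] by blast
  have MK: "M \<subseteq> complete_hypergraph t n" and dM: "disjoint M"
    using M unfolding monochromatic_matching_def by auto
  have fM: "finite M" using MK finite_complete_hypergraph finite_subset by blast
  have Mn: "e \<subseteq> {..<n}" if "e \<in> M" for e using that MK unfolding complete_hypergraph_def by auto
  have "real (card M) \<le> K * real n + real r"
  proof -
    obtain c where c: "c \<in> {1..r}" "\<And>e. e \<in> M \<Longrightarrow> \<psi> e = c"
    proof (cases "M = {}")
      case True
      then show thesis using that[of 1] assms(1) by auto
    next
      case False
      then obtain e where e: "e \<in> M" by blast
      obtain c where "\<forall>e\<in>M. \<psi> e = c" using M unfolding monochromatic_matching_def by auto
      then show thesis using that[of c] \<psi>[of e] e MK by auto
    qed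
    have wf: "0 \<le> w (f v) c \<and> w (f v) c \<le> 1" if "v < n" for v
      using that f(1) J(1) by (intro w) auto
    have "real (card M) = (\<Sum>e\<in>M. 1)" by simp
    also have "\<dots> \<le> (\<Sum>e\<in>M. \<Sum>v\<in>e. w (f v) c)"
    proof (rule sum_mono)
      fix e assume e: "e \<in> M"
      show "1 \<le> (\<Sum>v\<in>e. w (f v) c)"
        using \<psi>[of e] c(2)[OF e] MK e wt[OF Mn[OF e], of c] by auto
    qed
    also have "\<dots> = (\<Sum>v\<in>\<Union>M. w (f v) c)"
    proof -
      have "\<forall>e\<in>M. finite e" using Mn finite_subset by blast
      moreover have "\<forall>e\<in>M. \<forall>e'\<in>M. e \<noteq> e' \<longrightarrow> e \<inter> e' = {}" using dM unfolding disjoint_def by blast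
      ultimately show ?thesis
        using sum.Union_disjoint[of M "\<lambda>v. w (f v) c"] by (simp add: comp_def)
    qed
    also have "\<dots> \<le> (\<Sum>v\<in>{..<n}. w (f v) c)"
      using Mn wf by (intro sum_mono2) auto
    also have "\<dots> = (\<Sum>u\<in>J. real (card {v\<in>{..<n}. f v = u}) * w u c)"
      using sum_by_fibres[of "{..<n}" J f "\<lambda>u. w u c"] fJ f(1) by simp
    also have "\<dots> \<le> (\<Sum>u\<in>J. real n * (b u * w u c) + 1)"
    proof (rule sum_mono)
      fix u assume u: "u \<in> J"
      have wu: "0 \<le> w u c" "w u c \<le> 1" using w u J(1) by auto
      have "real (card {v\<in>{..<n}. f v = u}) \<le> b u * real n + 1"
        using f(2)[OF u] m(2)[OF u] by linarith
      then have "real (card {v\<in>{..<n}. f v = u}) * w u c \<le> (b u * real n + 1) * w u c"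
        using wu by (intro mult_right_mono)
      also have "\<dots> \<le> real n * (b u * w u c) + 1"
        using wu by (simp add: algebra_simps)
      finally show "real (card {v\<in>{..<n}. f v = u}) * w u c \<le> real n * (b u * w u c) + 1" .
    qed
    also have "\<dots> = real n * (\<Sum>u\<in>J. b u * w u c) + real (card J)"
      by (simp add: sum.distrib sum_distrib_left)
    also have "\<dots> \<le> real n * K + real r"
      using bspec[OF bK c(1)] J(2) by (intro add_mono mult_left_mono) auto
    finally show ?thesis by (simp add: mult.commute)
  qed
  then show ?thesis using colouring strip cM by auto
qed

section \<open>Holes in random hypergraphs\<close>

definition no_hole :: "nat \<Rightarrow> nat \<Rightarrow> real \<Rightarrow> nat set set \<Rightarrow> bool" where
  "no_hole t n h E \<longleftrightarrow> (\<forall>X. disjoint_family_on X {..<t} \<longrightarrow>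
     (\<forall>j<t. X j \<subseteq> {..<n} \<and> h \<le> real (card (X j))) \<longrightarrow> crossed_by t X E)"

lemma prob_random_hypergraph_avoids:
  assumes F: "F \<subseteq> complete_hypergraph t n" and p: "0 \<le> p" "p \<le> 1"
  shows "measure_pmf.prob (random_hypergraph t n p) {E. E \<inter> F = {}} = (1 - p) ^ card F"
proof -
  let ?K = "complete_hypergraph t n"
  have fin: "finite ?K" by (rule finite_complete_hypergraph)
  define B where "B e = (if e \<in> F then {False} else UNIV)" for e
  have "(\<lambda>f. {e \<in> ?K. f e}) -` {E. E \<inter> F = {}} = Pi ?K B"
  proof (intro set_eqI iffI)
    fix f assume f: "f \<in> (\<lambda>f. {e \<in> ?K. f e}) -` {E. E \<inter> F = {}}"
    show "f \<in> Pi ?K B"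
    proof (rule Pi_I)
      fix e assume "e \<in> ?K"
      then show "f e \<in> B e" using f unfolding B_def by auto
    qed
  next
    fix f assume f: "f \<in> Pi ?K B"
    have "\<not> f e" if "e \<in> F" for e
      using Pi_mem[OF f, of e] that F unfolding B_def by auto
    then show "f \<in> (\<lambda>f. {e \<in> ?K. f e}) -` {E. E \<inter> F = {}}" by auto
  qed
  then have "measure_pmf.prob (random_hypergraph t n p) {E. E \<inter> F = {}}
      = measure_pmf.prob (Pi_pmf ?K False (\<lambda>_. bernoulli_pmf p)) (Pi ?K B)"
    unfolding random_hypergraph_def by (simp add: measure_map_pmf)
  also have "\<dots> = (\<Prod>e\<in>?K. measure_pmf.prob (bernoulli_pmf p) (B e))"
    by (rule measure_Pi_pmf_Pi[OF fin])
  also have "\<dots> = (\<Prod>e\<in>?K. if e \<in> F then 1 - p else 1)"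
  proof (rule prod.cong)
    fix e assume "e \<in> ?K"
    show "measure_pmf.prob (bernoulli_pmf p) (B e) = (if e \<in> F then 1 - p else 1)"
      unfolding B_def using p by (simp add: measure_pmf_single)
  qed simp
  also have "\<dots> = (\<Prod>e\<in>F. 1 - p)"
    using fin F by (simp add: prod.If_cases Int_absorb1)
  finally show ?thesis by simp
qed

text \<open>Union bound over the at most \<open>(2 ^ n) ^ t\<close> tuples: a fixed one has at least \<open>h ^ t\<close> crossing
\<open>t\<close>-sets, all of which have to be missing.\<close>

lemma prob_hole_le:
  assumes p: "0 \<le> p" "p \<le> 1" and h: "0 \<le> h"
  shows "measure_pmf.prob (random_hypergraph t n p) {E. \<not> no_hole t n h E}
           \<le> (2 ^ n) ^ t * exp (- p * h ^ t)"
proof -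
  define XS where "XS = {X \<in> PiE {..<t} (\<lambda>_. Pow {..<n}).
      disjoint_family_on X {..<t} \<and> (\<forall>j<t. h \<le> real (card (X j)))}"
  define F where "F X = (\<lambda>x. x ` {..<t}) ` PiE {..<t} X" for X :: "nat \<Rightarrow> nat set"
  have fPi: "finite (PiE {..<t} (\<lambda>_. Pow {..<n}))" by (intro finite_PiE) auto
  have fXS: "finite XS" unfolding XS_def using fPi by simp
  have "card XS \<le> card (PiE {..<t} (\<lambda>_. Pow {..<n}))"
    unfolding XS_def using fPi by (intro card_mono) auto
  then have cXS: "card XS \<le> (2 ^ n) ^ t" by (simp add: card_PiE card_Pow)
  have sub: "{E. \<not> no_hole t n h E} \<subseteq> (\<Union>X\<in>XS. {E. E \<inter> F X = {}})"
  proof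
    fix E assume "E \<in> {E. \<not> no_hole t n h E}"
    then obtain X where X: "disjoint_family_on X {..<t}"
      "\<forall>j<t. X j \<subseteq> {..<n} \<and> h \<le> real (card (X j))" "\<not> crossed_by t X E"
      unfolding no_hole_def by auto
    define Y where "Y = restrict X {..<t}"
    have "Y \<in> XS"
      using X(1,2) unfolding XS_def Y_def disjoint_family_on_def by auto
    moreover have "E \<inter> F Y = {}"
    proof (rule equals0I)
      fix e assume "e \<in> E \<inter> F Y"
      then obtain x where "x \<in> PiE {..<t} Y" "e = x ` {..<t}" "e \<in> E" unfolding F_def by auto
      then have "(\<forall>j<t. x j \<in> X j) \<and> x ` {..<t} \<in> E" unfolding Y_def by (auto simp: PiE_iff)
      then show False using X(3) unfolding crossed_by_def by blast
    qed
    ultimately show "E \<in> (\<Union>X\<in>XS. {E. E \<inter> F X = {}})" by blast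
  qed
  have single: "measure_pmf.prob (random_hypergraph t n p) {E. E \<inter> F X = {}} \<le> exp (- p * h ^ t)"
    if X: "X \<in> XS" for X
  proof -
    have disj: "disjoint_family_on X {..<t}" and Xn: "\<And>j. j < t \<Longrightarrow> X j \<subseteq> {..<n}"
      and Xh: "\<And>j. j < t \<Longrightarrow> h \<le> real (card (X j))"
      using X unfolding XS_def by (auto simp: PiE_iff)
    have same: "i = j" if "x \<in> PiE {..<t} X" "y \<in> PiE {..<t} X" "i < t" "j < t" "x i = y j" for x y i j
    proof (rule ccontr)
      assume "i \<noteq> j"
      then have "X i \<inter> X j = {}" using disjoint_family_onD[OF disj, of i j] that by simp
      moreover have "x i \<in> X i" "y j \<in> X j"
        using PiE_mem[OF that(1), of i] PiE_mem[OF that(2), of j] that(3,4) by simp_all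
      ultimately show False using that(5) by auto
    qed
    have "inj_on (\<lambda>x. x ` {..<t}) (PiE {..<t} X)"
    proof (rule inj_onI)
      fix x y assume x: "x \<in> PiE {..<t} X" and y: "y \<in> PiE {..<t} X" and eq: "x ` {..<t} = y ` {..<t}"
      show "x = y"
      proof (rule PiE_ext[OF x y])
        fix i assume i: "i \<in> {..<t}"
        then have "x i \<in> y ` {..<t}" using eq by blast
        then obtain j where j: "j < t" "x i = y j" by auto
        then show "x i = y i" using same[OF x y _ j(1) j(2)] i by simp
      qed
    qed
    then have "card (F X) = (\<Prod>j<t. card (X j))"
      unfolding F_def by (simp add: card_image card_PiE)
    moreover have "h ^ t \<le> (\<Prod>j<t. real (card (X j)))"
      using prod_mono[of "{..<t}" "\<lambda>_. h" "\<lambda>j. real (card (X j))"] h Xh by simp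
    ultimately have cF: "h ^ t \<le> real (card (F X))" by simp
    have FK: "F X \<subseteq> complete_hypergraph t n"
    proof
      fix e assume "e \<in> F X"
      then obtain x where x: "x \<in> PiE {..<t} X" "e = x ` {..<t}" unfolding F_def by auto
      have "inj_on x {..<t}" using same[OF x(1) x(1)] by (intro inj_onI) simp
      then have "card e = t" unfolding x(2) by (simp add: card_image)
      moreover have "e \<subseteq> {..<n}" using x Xn by (fastforce simp: PiE_iff)
      ultimately show "e \<in> complete_hypergraph t n" unfolding complete_hypergraph_def by simp
    qed
    have "(1 - p) ^ card (F X) \<le> exp (- p) ^ card (F X)"
      using p exp_ge_add_one_self[of "- p"] by (intro power_mono) auto
    also have "\<dots> = exp (- p * real (card (F X)))" by (simp add: exp_of_nat_mult[symmetric] mult.commute)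
    also have "\<dots> \<le> exp (- p * h ^ t)" using p cF by (simp add: mult_left_mono)
    finally show ?thesis using prob_random_hypergraph_avoids[OF FK p] by simp
  qed
  have "measure_pmf.prob (random_hypergraph t n p) {E. \<not> no_hole t n h E}
      \<le> measure_pmf.prob (random_hypergraph t n p) (\<Union>X\<in>XS. {E. E \<inter> F X = {}})"
    by (intro measure_pmf.finite_measure_mono sub) simp
  also have "\<dots> \<le> (\<Sum>X\<in>XS. measure_pmf.prob (random_hypergraph t n p) {E. E \<inter> F X = {}})"
    using fXS by (intro measure_pmf.finite_measure_subadditive_finite) auto
  also have "\<dots> \<le> (\<Sum>X\<in>XS. exp (- p * h ^ t))" by (intro sum_mono single)
  also have "\<dots> = real (card XS) * exp (- p * h ^ t)" by simp
  also have "\<dots> \<le> (2 ^ n) ^ t * exp (- p * h ^ t)"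
  proof (rule mult_right_mono)
    have "real (card XS) \<le> real ((2 ^ n) ^ t)" using cXS of_nat_le_iff by blast
    then show "real (card XS) \<le> (2 ^ n) ^ t" by simp
  qed simp
  finally show ?thesis .
qed

text \<open>At density \<open>C * n powi (1 - t)\<close> the exponent in the previous bound is linear in \<open>n\<close> with a factor
\<open>C * \<theta> ^ t\<close>, so that a large \<open>C\<close> beats the exponential number of tuples.\<close>

lemma no_hole_whp:
  fixes p :: "nat \<Rightarrow> real"
  assumes t: "t \<ge> 1" and \<theta>: "\<theta> > 0" and C: "C * \<theta> ^ t \<ge> real t * ln 2 + 1"
    and p: "\<And>n. 0 \<le> p n \<and> p n \<le> 1"
    and large: "\<forall>\<^sub>F n in sequentially. C * real n powi (- int t + 1) \<le> p n"
  shows "(\<lambda>n. measure_pmf.prob (random_hypergraph t n (p n)) {E. \<not> no_hole t n (\<theta> * real n) E}) \<longlonglongrightarrow> 0"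
proof (rule tendsto_sandwich[of "\<lambda>_. 0" _ _ "\<lambda>n. exp (- real n)"])
  show "(\<lambda>n. exp (- real n)) \<longlonglongrightarrow> 0"
  proof -
    have "(\<lambda>n. exp (- 1 :: real) ^ n) \<longlonglongrightarrow> 0" by (intro LIMSEQ_realpow_zero) auto
    then show ?thesis by (simp add: exp_of_nat_mult[symmetric])
  qed
  show "\<forall>\<^sub>F n in sequentially. measure_pmf.prob (random_hypergraph t n (p n)) {E. \<not> no_hole t n (\<theta> * real n) E}
      \<le> exp (- real n)"
    using large eventually_gt_at_top[of "0::nat"]
  proof eventually_elim
    case (elim n)
    have "real n powi (- int t + 1) * real n ^ t = real n"
    proof -
      have "real n powi (- int t + 1) * real n powi (int t) = real n powi ((- int t + 1) + int t)"
        using elim by (intro power_int_add[symmetric]) simp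
      then show ?thesis by simp
    qed
    then have "C * real n powi (- int t + 1) * (\<theta> * real n) ^ t = (C * \<theta> ^ t) * real n"
      by (simp add: power_mult_distrib algebra_simps)
    moreover have "C * real n powi (- int t + 1) * (\<theta> * real n) ^ t \<le> p n * (\<theta> * real n) ^ t"
      using elim \<theta> by (intro mult_right_mono) auto
    moreover have "(real t * ln 2 + 1) * real n \<le> (C * \<theta> ^ t) * real n"
      using C by (intro mult_right_mono) auto
    ultimately have le: "(real t * ln 2 + 1) * real n \<le> p n * (\<theta> * real n) ^ t" by linarith
    have "(2::real) ^ n = exp (real n * ln 2)" by (simp add: exp_of_nat_mult)
    then have two: "((2::real) ^ n) ^ t = exp (real t * (real n * ln 2))" by (simp add: exp_of_nat_mult)
    have "measure_pmf.prob (random_hypergraph t n (p n)) {E. \<not> no_hole t n (\<theta> * real n) E}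
        \<le> (2 ^ n) ^ t * exp (- p n * (\<theta> * real n) ^ t)"
      using p \<theta> by (intro prob_hole_le) auto
    also have "\<dots> = exp (real t * (real n * ln 2) - p n * (\<theta> * real n) ^ t)"
      unfolding two by (simp add: mult_exp_exp)
    also have "\<dots> \<le> exp (- real n)" using le by (simp add: algebra_simps)
    finally show ?case .
  qed
qed (auto intro: always_eventually)

section \<open>Colourings of hypergraphs without holes\<close>

text \<open>For every colour there is a cover by weights of total value about \<open>\<nu>\<close>, constant on boundedly many
levels. The vectors of the \<open>r\<close> levels of a vertex are the types. Any \<open>t\<close> types with many vertices
contain a tuple that is hole-free in some colour, and since this tuple is covered in that colour,
the weights of the \<open>t\<close> types add up to at least 1 there. So the frequent types satisfy the
hypotheses of the previous construction; the rare ones are dropped, which costs little because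
the number of types is bounded independently of \<open>n\<close>.

The constants are chosen in the order \<open>\<eta>\<close>, \<open>L\<close>, \<open>\<delta>\<close>, \<open>\<beta>\<close>, \<open>\<theta>\<close>: a type is frequent if it has at
least \<open>\<beta> * n\<close> vertices, and \<open>\<theta> * n\<close> is the size of the sets left after \<open>r\<close> passages to holes.\<close>

lemma strip_colouring_of_hypergraph_without_holes:
  fixes \<epsilon> :: real
  assumes t: "t \<ge> 1" and r: "r \<ge> 1" and \<epsilon>: "0 < \<epsilon>" "\<epsilon> \<le> 1"
  shows "\<exists>\<theta>>0. \<exists>n0. \<forall>n\<ge>n0. \<forall>E \<phi>. E \<subseteq> complete_hypergraph t n \<longrightarrow> no_hole t n (\<theta> * real n) E \<longrightarrow>
           edge_colouring r E \<phi> \<longrightarrow>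
           (\<exists>\<psi>. edge_colouring r (complete_hypergraph t n) \<psi> \<and> strip_colouring r t n \<psi> \<and>
              real (mono_matching_number E \<phi>)
                \<ge> real (mono_matching_number (complete_hypergraph t n) \<psi>) - \<epsilon> * real n)"
proof -
  define \<eta> where "\<eta> = \<epsilon> / 32"
  define L where "L = nat \<lceil>32 / (\<epsilon> * \<eta>)\<rceil>"
  define \<delta> where "\<delta> = \<epsilon> / (32 * real L)"
  define \<beta> where "\<beta> = \<epsilon> / (16 * real ((L + 1) ^ r))"
  define \<theta> where "\<theta> = \<delta> ^ r * \<beta> / (2 * real t)"
  define N where "N = nat \<lceil>real L / \<theta>\<rceil>"
  define n0 where "n0 = nat \<lceil>2 * real t / \<beta>\<rceil> + nat \<lceil>16 * real (N * 2 ^ (N * t)) / \<epsilon>\<rceil>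
      + nat \<lceil>4 * real r / \<epsilon>\<rceil> + 1"
  have \<eta>: "0 < \<eta>" "\<eta> \<le> 1" using \<epsilon> unfolding \<eta>_def by auto
  have L_ge: "32 / (\<epsilon> * \<eta>) \<le> real L" unfolding L_def by linarith
  moreover have "0 < 32 / (\<epsilon> * \<eta>)" using \<epsilon> \<eta> by simp
  ultimately have L0: "0 < real L" by linarith
  then have L: "L > 0" by simp
  have \<delta>L: "\<delta> * L = \<epsilon> / 32" using L unfolding \<delta>_def by simp
  have L1: "1 / (\<eta> * L) \<le> \<epsilon> / 32"
  proof -
    have "32 \<le> real L * (\<epsilon> * \<eta>)" using L_ge \<epsilon> \<eta> by (simp add: pos_divide_le_eq)
    then have "1 \<le> (\<epsilon> / 32) * (\<eta> * L)" by (simp add: mult_ac)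
    then show ?thesis using \<eta> L0 by (subst pos_divide_le_eq) auto
  qed
  have \<delta>0: "0 < \<delta>" using \<epsilon> L unfolding \<delta>_def by simp
  have "\<delta> * 1 \<le> \<delta> * L" using \<delta>0 L by (intro mult_left_mono) auto
  then have \<delta>1: "\<delta> \<le> 1" using \<delta>L \<epsilon> by linarith
  have \<beta>0: "0 < \<beta>" using \<epsilon> unfolding \<beta>_def by simp
  have \<theta>0: "0 < \<theta>" using \<delta>0 \<beta>0 t unfolding \<theta>_def by simp
  have "\<exists>\<psi>. edge_colouring r (complete_hypergraph t n) \<psi> \<and> strip_colouring r t n \<psi> \<and>
              real (mono_matching_number E \<phi>)
                \<ge> real (mono_matching_number (complete_hypergraph t n) \<psi>) - \<epsilon> * real n"
    if "n \<ge> n0" and E: "E \<subseteq> complete_hypergraph t n"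
      and nh: "no_hole t n (\<theta> * real n) E" and \<phi>: "edge_colouring r E \<phi>" for n E \<phi>
  proof -
    define V where "V = {..<n}"
    have V: "finite V" "card V = n" unfolding V_def by auto
    have n1: "2 * real t / \<beta> \<le> real n" "16 * real (N * 2 ^ (N * t)) / \<epsilon> \<le> real n"
      "4 * real r / \<epsilon> \<le> real n" "n > 0"
      using \<open>n \<ge> n0\<close> unfolding n0_def by linarith+
    have n\<beta>: "2 * real t \<le> \<beta> * real n" using n1(1) \<beta>0 by (simp add: pos_divide_le_eq mult.commute)
    have nN: "real (N * 2 ^ (N * t)) \<le> \<epsilon> / 16 * real n" using n1(2) \<epsilon> by (simp add: pos_divide_le_eq mult.commute)
    have nr: "real r \<le> \<epsilon> / 4 * real n" using n1(3) \<epsilon> by (simp add: pos_divide_le_eq mult.commute)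
    have VU: "V \<noteq> {}" using n1(4) unfolding V_def by auto
    have fE: "finite E" using E finite_complete_hypergraph finite_subset by blast
    define k where "k = mono_matching_number E \<phi>"
    have kn: "k \<le> n"
    proof -
      obtain M where M: "monochromatic_matching E \<phi> M" "card M = k"
        using mono_matching_number_attained[OF fE] unfolding k_def by blast
      have ME: "M \<subseteq> E" and dM: "disjoint M" using M unfolding monochromatic_matching_def by auto
      have e: "e \<subseteq> V \<and> e \<noteq> {}" if "e \<in> M" for e
        using that ME E t unfolding complete_hypergraph_def V_def by auto
      have "inj_on (\<lambda>e. SOME v. v \<in> e) M"
      proof (rule inj_onI)
        fix e e' assume *: "e \<in> M" "e' \<in> M" "(SOME v. v \<in> e) = (SOME v. v \<in> e')"
        have "(SOME v. v \<in> e) \<in> e \<inter> e'"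
          using some_in_eq[of e] some_in_eq[of e'] e[OF *(1)] e[OF *(2)] *(3) by simp
        then show "e = e'" using dM *(1,2) unfolding disjoint_def by blast
      qed
      moreover have "(\<lambda>e. SOME v. v \<in> e) ` M \<subseteq> V"
        using e some_in_eq by blast
      ultimately show ?thesis using card_inj_on_le[of _ M V] V M(2) by blast
    qed
    \<comment> \<open>The slack \<open>\<epsilon> / 2\<close> absorbs the rounding losses, so that a packing of this value would
      yield more than \<open>k\<close> disjoint edges of one colour.\<close>
    define \<kappa> where "\<kappa> = real k / real n + \<epsilon> / 2"
    have \<kappa>n: "\<kappa> * real n = real k + \<epsilon> / 2 * real n"
      using n1(4) unfolding \<kappa>_def by (simp add: algebra_simps)
    have "real k / real n \<le> 1" using kn n1(4) by simp
    then have \<kappa>: "0 < \<kappa>" "\<kappa> \<le> 2"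
      using \<epsilon> unfolding \<kappa>_def by (auto simp: add_nonneg_pos)
    have "\<forall>c\<in>{1..r}. \<exists>l \<omega>. (\<forall>v\<in>V. l v \<le> L) \<and> (\<forall>k::nat. 0 \<le> \<omega> k) \<and> (\<Sum>v\<in>V. \<omega> (l v)) = \<kappa> * real (card V) \<and>
      covers_level_tuples t V {e\<in>E. \<phi> e = c} (\<theta> * real (card V)) \<delta> l \<omega>"
    proof
      fix c
      show "\<exists>l \<omega>. (\<forall>v\<in>V. l v \<le> L) \<and> (\<forall>k::nat. 0 \<le> \<omega> k) \<and> (\<Sum>v\<in>V. \<omega> (l v)) = \<kappa> * real (card V) \<and>
        covers_level_tuples t V {e\<in>E. \<phi> e = c} (\<theta> * real (card V)) \<delta> l \<omega>"
      proof (rule fractional_cover_of_hole_free_tuples[OF V(1) VU _ L \<eta> \<kappa> \<delta>0 \<theta>0])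
        show "t > 0" using t by simp
        show "real (card Q) \<le> real k" if "Q \<subseteq> {e\<in>E. \<phi> e = c}" "finite Q" "disjoint Q" for Q
        proof -
          have "monochromatic_matching E \<phi> Q"
            unfolding monochromatic_matching_def using that by blast
          then show ?thesis unfolding k_def using card_le_mono_matching_number[OF fE] by simp
        qed
        show "real L / \<theta> \<le> real N" unfolding N_def by linarith
        have "\<kappa> - \<epsilon> / 8 \<le> \<kappa> - 2 * \<eta> - 1 / (\<eta> * L) - \<delta> * L"
          using L1 \<delta>L unfolding \<eta>_def by simp
        then have "(\<kappa> - \<epsilon> / 8) * real n \<le> (\<kappa> - 2 * \<eta> - 1 / (\<eta> * L) - \<delta> * L) * card V"
          unfolding V(2) by (intro mult_right_mono) auto
        moreover have "(\<kappa> - \<epsilon> / 8) * real n = real k + 3 / 8 * (\<epsilon> * real n)"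
          using \<kappa>n by (simp add: algebra_simps)
        moreover have "0 < \<epsilon> * real n" using \<epsilon> n1(4) by simp
        ultimately show "real k < (\<kappa> - 2 * \<eta> - 1 / (\<eta> * L) - \<delta> * L) * card V - real (N * 2 ^ (N * t))"
          using nN by linarith
      qed
    qed
    from bchoice[OF this] obtain l where l: "\<forall>c\<in>{1..r}. \<exists>\<omega>. (\<forall>v\<in>V. l c v \<le> L) \<and> (\<forall>k::nat. 0 \<le> \<omega> k) \<and>
        (\<Sum>v\<in>V. \<omega> (l c v)) = \<kappa> * real (card V) \<and>
        covers_level_tuples t V {e\<in>E. \<phi> e = c} (\<theta> * real (card V)) \<delta> (l c) \<omega>"
      by (elim exE)
    from bchoice[OF this] obtain \<omega> where lw: "\<forall>c\<in>{1..r}. (\<forall>v\<in>V. l c v \<le> L) \<and> (\<forall>k::nat. 0 \<le> \<omega> c k) \<and>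
        (\<Sum>v\<in>V. \<omega> c (l c v)) = \<kappa> * real (card V) \<and>
        covers_level_tuples t V {e\<in>E. \<phi> e = c} (\<theta> * real (card V)) \<delta> (l c) (\<omega> c)"
      by (elim exE)
    have lL: "l c v \<le> L" if "c \<in> {1..r}" "v \<in> V" for c v using lw that by simp
    have w0: "0 \<le> \<omega> c k" if "c \<in> {1..r}" for c k using lw that by simp
    have wsum: "(\<Sum>v\<in>V. \<omega> c (l c v)) = \<kappa> * real n" if "c \<in> {1..r}" for c using lw that V(2) by simp
    have cover: "real b \<le> (\<Sum>j<t. \<Sum>v\<in>A j. \<omega> c (l c v))"
      if "c \<in> {1..r}" "\<forall>j<t. A j \<subseteq> V \<and> card (A j) = b" "disjoint_family_on A {..<t}"
         "\<theta> * real n \<le> real b" "hole_free t {e\<in>E. \<phi> e = c} A (\<delta> * real b)"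
         "\<forall>j<t. \<forall>u\<in>A j. \<forall>v\<in>A j. l c u = l c v" for c A b
    proof -
      have "covers_level_tuples t V {e\<in>E. \<phi> e = c} (\<theta> * real n) \<delta> (l c) (\<omega> c)"
        using bspec[OF lw that(1)] unfolding V(2) by (elim conjE)
      note this[unfolded covers_level_tuples_def, THEN spec, THEN spec, of A b]
      from mp[OF mp[OF mp[OF mp[OF mp[OF this that(2)] that(3)] that(4)] that(5)] that(6)]
      show ?thesis .
    qed
    define T where "T = PiE {1..r} (\<lambda>_. {..L})"
    define g where "g v = restrict (\<lambda>c. l c v) {1..r}" for v
    define U where "U = {u \<in> T. \<beta> * real n \<le> real (card {v\<in>V. g v = u})}"
    have fT: "finite T" unfolding T_def by (intro finite_PiE) auto
    have cT: "card T = (L + 1) ^ r" unfolding T_def by (simp add: card_PiE)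
    have gT: "g ` V \<subseteq> T" using lL unfolding g_def T_def by auto
    have fU: "finite U" "U \<subseteq> T" using fT unfolding U_def by auto
    have gl: "l c v = g v c" if "c \<in> {1..r}" for c v using that unfolding g_def by simp
    define s where "s = (\<Sum>u\<in>U. real (card {v\<in>V. g v = u}))"
    have s_ge: "(1 - \<epsilon> / 16) * real n \<le> s"
    proof -
      have "real n = (\<Sum>u\<in>T. real (card {v\<in>V. g v = u}))"
        using sum_by_fibres[OF V(1) fT gT, of "\<lambda>_. 1"] V(2) by simp
      also have "\<dots> = (\<Sum>u\<in>T - U. real (card {v\<in>V. g v = u})) + s"
        unfolding s_def by (rule sum.subset_diff[OF fU(2) fT])
      also have "(\<Sum>u\<in>T - U. real (card {v\<in>V. g v = u})) \<le> (\<Sum>u\<in>T - U. \<beta> * real n)"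
        unfolding U_def by (intro sum_mono) auto
      also have "(\<Sum>u\<in>T - U. \<beta> * real n) \<le> real (card T) * (\<beta> * real n)"
        using \<beta>0 fT by (simp add: card_mono mult_right_mono)
      also have "\<dots> = \<epsilon> / 16 * real n" unfolding cT \<beta>_def by simp
      finally show ?thesis by (simp add: algebra_simps)
    qed
    have "0 < (1 - \<epsilon> / 16) * real n" using \<epsilon> n1(4) by simp
    then have s0: "0 < s" using s_ge by linarith
    define a where "a u = real (card {v\<in>V. g v = u}) / s" for u
    define w where "w u c = (if c \<in> {1..r} then min 1 (\<omega> c (u c)) else 0)" for u c
    have "\<exists>\<psi>. edge_colouring r (complete_hypergraph t n) \<psi> \<and> strip_colouring r t n \<psi> \<and>
           real (mono_matching_number (complete_hypergraph t n) \<psi>) \<le> (\<kappa> + \<epsilon> / 4) * real n + real r"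
    proof (rule strip_colouring_from_covering_weights[OF r fU(1)])
      show "0 \<le> a u" for u unfolding a_def using s0 by simp
      show "(\<Sum>u\<in>U. a u) = 1"
        unfolding a_def using s0 by (simp add: sum_divide_distrib[symmetric] s_def)
      show "0 \<le> w u c \<and> w u c \<le> 1" for u c unfolding w_def using w0 by simp
      show "(\<Sum>u\<in>U. a u * w u c) \<le> \<kappa> + \<epsilon> / 4" if c: "c \<in> {1..r}" for c
      proof -
        have "(\<Sum>u\<in>U. a u * w u c) = (\<Sum>u\<in>U. real (card {v\<in>V. g v = u}) * w u c) / s"
          unfolding a_def by (simp add: sum_divide_distrib)
        also have "\<dots> \<le> (\<Sum>u\<in>T. real (card {v\<in>V. g v = u}) * \<omega> c (u c)) / s"
        proof (intro divide_right_mono)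
          have "(\<Sum>u\<in>U. real (card {v\<in>V. g v = u}) * w u c)
              \<le> (\<Sum>u\<in>U. real (card {v\<in>V. g v = u}) * \<omega> c (u c))"
            unfolding w_def using c by (intro sum_mono mult_left_mono) auto
          also have "\<dots> \<le> (\<Sum>u\<in>T. real (card {v\<in>V. g v = u}) * \<omega> c (u c))"
            using fU fT w0[OF c] by (intro sum_mono2) auto
          finally show "(\<Sum>u\<in>U. real (card {v\<in>V. g v = u}) * w u c)
              \<le> (\<Sum>u\<in>T. real (card {v\<in>V. g v = u}) * \<omega> c (u c))" .
        qed (use s0 in simp)
        also have "(\<Sum>u\<in>T. real (card {v\<in>V. g v = u}) * \<omega> c (u c)) = \<kappa> * real n"
          using sum_by_fibres[OF V(1) fT gT, of "\<lambda>u. \<omega> c (u c)"] wsum[OF c] unfolding gl[OF c] by simp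
        also have "\<kappa> * real n / s \<le> \<kappa> * real n / ((1 - \<epsilon> / 16) * real n)"
          using s_ge \<kappa> \<epsilon> n1(4) s0 by (intro divide_left_mono) auto
        also have "\<dots> = \<kappa> / (1 - \<epsilon> / 16)" using n1(4) by simp
        also have "\<dots> \<le> \<kappa> + \<epsilon> / 4"
        proof -
          have "\<kappa> * (\<epsilon> / 16) \<le> 2 * (\<epsilon> / 16)" using \<kappa> \<epsilon> by (intro mult_right_mono) auto
          moreover have "\<epsilon> / 4 * (\<epsilon> / 16) \<le> \<epsilon> / 4 * (1 / 16)" using \<epsilon> by (intro mult_left_mono) auto
          moreover have "(\<kappa> + \<epsilon> / 4) * (1 - \<epsilon> / 16) = \<kappa> + \<epsilon> / 4 - \<kappa> * (\<epsilon> / 16) - \<epsilon> / 4 * (\<epsilon> / 16)"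
            by (simp add: algebra_simps)
          ultimately have "\<kappa> \<le> (\<kappa> + \<epsilon> / 4) * (1 - \<epsilon> / 16)" using \<epsilon> by linarith
          then show ?thesis using \<epsilon> by (subst pos_divide_le_eq) auto
        qed
        finally show ?thesis .
      qed
      show "\<exists>c\<in>{1..r}. 1 \<le> (\<Sum>j<t. w (u j) c)" if u: "\<forall>j<t. u j \<in> U" for u
      proof -
        define m where "m = nat \<lfloor>\<beta> * real n / real t\<rfloor>"
        have bnt: "2 \<le> \<beta> * real n / real t" using n\<beta> t by (simp add: pos_le_divide_eq)
        have "real (nat \<lfloor>q\<rfloor>) \<le> q \<and> q / 2 \<le> real (nat \<lfloor>q\<rfloor>)" if "2 \<le> q" for q :: real
          using that by linarith
        note this[OF bnt, folded m_def]
        then have m_le: "real m \<le> \<beta> * real n / real t"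
          and m_ge: "\<beta> * real n / real t / 2 \<le> real m"
          by (rule conjunct1, rule conjunct2)
        have tm: "real t * real m \<le> \<beta> * real n" using m_le t by (simp add: pos_le_divide_eq mult.commute)
        have "finite {v\<in>V. g v = u j} \<and> t * m \<le> card {v\<in>V. g v = u j}" if "j < t" for j
        proof -
          have "real (t * m) \<le> real (card {v\<in>V. g v = u j})"
            using u that tm unfolding U_def by fastforce
          then show ?thesis using V(1) by (simp only: of_nat_le_iff) simp
        qed
        then have "\<exists>A. disjoint_family_on A {..<t} \<and> (\<forall>j<t. A j \<subseteq> {v\<in>V. g v = u j} \<and> card (A j) = m)"
          by (rule disjoint_subfamily)
        then obtain A where Ad: "disjoint_family_on A {..<t}"
          and A: "\<forall>j<t. A j \<subseteq> {v\<in>V. g v = u j} \<and> card (A j) = m"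
          by (elim exE conjE)
        have \<theta>m: "\<theta> * real n \<le> \<delta> ^ card {1..r} * real m"
        proof -
          have "\<delta> ^ r * (\<beta> * real n / real t / 2) \<le> \<delta> ^ r * real m"
            using m_ge \<delta>0 by (intro mult_left_mono) auto
          then show ?thesis unfolding \<theta>_def by simp
        qed
        have AV: "A j \<subseteq> V" if "j < t" for j using A that by auto
        have "\<exists>c\<in>{1..r}. \<exists>B b. (\<forall>j<t. B j \<subseteq> A j \<and> card (B j) = b) \<and> \<delta> ^ card {1..r} * real m \<le> real b \<and>
           hole_free t {e \<in> E. \<phi> e = c} B (\<delta> * real b)"
        proof (rule monochromatic_hole_free_subtuple[OF _ \<delta>0 \<delta>1])
          show "finite (A j) \<and> real m \<le> real (card (A j))" if "j < t" for j
            using A AV[OF that] that V(1) finite_subset by auto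
          show "hole_free t E A (\<delta> ^ card {1..r} * real m)"
            unfolding hole_free_def
          proof (intro allI impI)
            fix X assume X: "\<forall>j<t. X j \<subseteq> A j \<and> \<delta> ^ card {1..r} * real m \<le> real (card (X j))"
            have "disjoint_family_on X {..<t}"
            proof (rule disjoint_family_on_bisimulation[OF Ad])
              fix i j assume "i \<in> {..<t}" "j \<in> {..<t}" "A i \<inter> A j = {}"
              then show "X i \<inter> X j = {}" using X by blast
            qed
            moreover have "\<forall>j<t. X j \<subseteq> {..<n} \<and> \<theta> * real n \<le> real (card (X j))"
              using X AV \<theta>m unfolding V_def by force
            ultimately show "crossed_by t X E" using nh unfolding no_hole_def by simp
          qed
          show "\<phi> (x ` {..<t}) \<in> {1..r}" if "x ` {..<t} \<in> E" for x
            using \<phi> that unfolding edge_colouring_def by blast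
        qed auto
        then obtain c B b where c: "c \<in> {1..r}" and B: "\<forall>j<t. B j \<subseteq> A j \<and> card (B j) = b"
          and b: "\<delta> ^ card {1..r} * real m \<le> real b" and hf: "hole_free t {e \<in> E. \<phi> e = c} B (\<delta> * real b)"
          by (elim bexE exE conjE)
        have Bl: "\<omega> c (l c v) = \<omega> c (u j c)" "l c v = u j c" if "j < t" "v \<in> B j" for j v
        proof -
          have "v \<in> A j" "A j \<subseteq> {v\<in>V. g v = u j}" using A B that by blast+
          then have "g v = u j" by blast
          then show "l c v = u j c" using gl[OF c, of v] by simp
          then show "\<omega> c (l c v) = \<omega> c (u j c)" by simp
        qed
        have "real b \<le> (\<Sum>j<t. \<Sum>v\<in>B j. \<omega> c (l c v))"
        proof (rule cover[OF c _ _ _ hf])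
          show "\<forall>j<t. B j \<subseteq> V \<and> card (B j) = b" using B AV by blast
          show "disjoint_family_on B {..<t}"
          proof (rule disjoint_family_on_bisimulation[OF Ad])
            fix i j assume "i \<in> {..<t}" "j \<in> {..<t}" "A i \<inter> A j = {}"
            then show "B i \<inter> B j = {}" using B by blast
          qed
          show "\<theta> * real n \<le> real b" using \<theta>m b by linarith
          show "\<forall>j<t. \<forall>u\<in>B j. \<forall>v\<in>B j. l c u = l c v" using Bl(2) by simp
        qed
        also have "\<dots> = (\<Sum>j<t. real b * \<omega> c (u j c))"
        proof (rule sum.cong)
          fix j assume j: "j \<in> {..<t}"
          have "(\<Sum>v\<in>B j. \<omega> c (l c v)) = (\<Sum>v\<in>B j. \<omega> c (u j c))"
            using Bl(1) j by (intro sum.cong) auto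
          then show "(\<Sum>v\<in>B j. \<omega> c (l c v)) = real b * \<omega> c (u j c)" using B j by simp
        qed simp
        also have "\<dots> = real b * (\<Sum>j<t. \<omega> c (u j c))" by (simp add: sum_distrib_left)
        finally have "real b * 1 \<le> real b * (\<Sum>j<t. \<omega> c (u j c))" by simp
        moreover have "0 < real b"
        proof -
          have "0 < \<theta> * real n" using \<theta>0 n1(4) by simp
          then show ?thesis using \<theta>m b by linarith
        qed
        ultimately have ge1: "1 \<le> (\<Sum>j<t. \<omega> c (u j c))" by (simp only: mult_le_cancel_left_pos)
        \<comment> \<open>Capping the weights at 1 preserves the cover, since a capped weight suffices alone.\<close>
        have "1 \<le> (\<Sum>j<t. w (u j) c)"
        proof (cases "\<exists>i<t. 1 \<le> \<omega> c (u i c)")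
          case True
          then obtain i where i: "i < t" "1 \<le> \<omega> c (u i c)" by blast
          then have "1 = w (u i) c" unfolding w_def using c by simp
          also have "\<dots> \<le> (\<Sum>j<t. w (u j) c)"
            using i(1) w0[OF c] c unfolding w_def by (intro member_le_sum) auto
          finally show ?thesis .
        next
          case False
          then have "(\<Sum>j<t. w (u j) c) = (\<Sum>j<t. \<omega> c (u j c))"
            unfolding w_def using c by (intro sum.cong) auto
          then show ?thesis using ge1 by simp
        qed
        then show ?thesis using c by blast
      qed
    qed
    then obtain \<psi> where \<psi>: "edge_colouring r (complete_hypergraph t n) \<psi>" "strip_colouring r t n \<psi>"
      "real (mono_matching_number (complete_hypergraph t n) \<psi>) \<le> (\<kappa> + \<epsilon> / 4) * real n + real r"
      by (elim exE conjE)
    have "(\<kappa> + \<epsilon> / 4) * real n + real r \<le> real k + \<epsilon> * real n"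
      using \<kappa>n nr by (simp add: algebra_simps)
    then have "real (mono_matching_number E \<phi>)
        \<ge> real (mono_matching_number (complete_hypergraph t n) \<psi>) - \<epsilon> * real n"
      using \<psi>(3) unfolding k_def by linarith
    then show ?thesis using \<psi>(1,2) by blast
  qed
  then show ?thesis using \<theta>0 by blast
qed

section \<open>Random hypergraphs\<close>

lemma set_random_hypergraph: "E \<in> set_pmf (random_hypergraph t n p) \<Longrightarrow> E \<subseteq> complete_hypergraph t n"
  unfolding random_hypergraph_def by auto

theorem theorem1p4:
  fixes t r :: nat and \<epsilon> :: real
  assumes "t \<ge> 2" and "r \<ge> 2" and "\<epsilon> > 0"
  shows "\<exists>C>0. \<forall>p :: nat \<Rightarrow> real.
           (\<forall>n. 0 \<le> p n \<and> p n \<le> 1) \<longrightarrow>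
           (\<forall>\<^sub>F n in sequentially. p n \<ge> C * real n powi (- int t + 1)) \<longrightarrow>
           (\<lambda>n. measure_pmf.prob (random_hypergraph t n (p n))
                  {E. \<forall>\<phi>. edge_colouring r E \<phi> \<longrightarrow>
                        (\<exists>\<psi>. edge_colouring r (complete_hypergraph t n) \<psi> \<and>
                             strip_colouring r t n \<psi> \<and>
                             real (mono_matching_number E \<phi>)
                               \<ge> real (mono_matching_number (complete_hypergraph t n) \<psi>)
                                  - \<epsilon> * real n)})
             \<longlonglongrightarrow> 1"
proof -
  define \<epsilon>' where "\<epsilon>' = min \<epsilon> 1"
  have \<epsilon>': "0 < \<epsilon>'" "\<epsilon>' \<le> 1" "\<epsilon>' \<le> \<epsilon>" using assms unfolding \<epsilon>'_def by auto
  have t: "t \<ge> 1" and r: "r \<ge> 1" using assms by auto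
  obtain \<theta> n0 where \<theta>: "\<theta> > 0" and strip: "\<forall>n\<ge>n0. \<forall>E \<phi>. E \<subseteq> complete_hypergraph t n \<longrightarrow>
      no_hole t n (\<theta> * real n) E \<longrightarrow> edge_colouring r E \<phi> \<longrightarrow>
      (\<exists>\<psi>. edge_colouring r (complete_hypergraph t n) \<psi> \<and> strip_colouring r t n \<psi> \<and>
         real (mono_matching_number E \<phi>)
           \<ge> real (mono_matching_number (complete_hypergraph t n) \<psi>) - \<epsilon>' * real n)"
    using strip_colouring_of_hypergraph_without_holes[OF t r \<epsilon>'(1,2)] by (elim exE conjE)
  define C where "C = (real t * ln 2 + 1) / \<theta> ^ t"
  have C: "C * \<theta> ^ t \<ge> real t * ln 2 + 1" using \<theta> unfolding C_def by simp
  have "C > 0" using \<theta> unfolding C_def by (intro divide_pos_pos add_nonneg_pos) auto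
  show ?thesis
  proof (intro exI[of _ C] conjI allI impI)
    show "C > 0" by fact
    fix p :: "nat \<Rightarrow> real"
    assume p: "\<forall>n. 0 \<le> p n \<and> p n \<le> 1"
      and large: "\<forall>\<^sub>F n in sequentially. p n \<ge> C * real n powi (- int t + 1)"
    define G :: "nat \<Rightarrow> nat set set set" where "G n = {E. \<forall>\<phi>. edge_colouring r E \<phi> \<longrightarrow>
        (\<exists>\<psi>. edge_colouring r (complete_hypergraph t n) \<psi> \<and> strip_colouring r t n \<psi> \<and>
           real (mono_matching_number E \<phi>)
             \<ge> real (mono_matching_number (complete_hypergraph t n) \<psi>) - \<epsilon> * real n)}" for n
    define hole where "hole n = {E. \<not> no_hole t n (\<theta> * real n) E}" for n
    let ?P = "\<lambda>n. measure_pmf.prob (random_hypergraph t n (p n))"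
    have "?P n (G n) \<ge> 1 - ?P n (hole n)" if n: "n \<ge> n0" for n
    proof -
      have "(UNIV - hole n) \<inter> set_pmf (random_hypergraph t n (p n)) \<subseteq> G n"
      proof
        fix E assume E: "E \<in> (UNIV - hole n) \<inter> set_pmf (random_hypergraph t n (p n))"
        have EK: "E \<subseteq> complete_hypergraph t n" using E set_random_hypergraph by blast
        have nh: "no_hole t n (\<theta> * real n) E" using E unfolding hole_def by simp
        show "E \<in> G n"
          unfolding G_def
        proof (intro CollectI allI impI)
          fix \<phi> assume \<phi>: "edge_colouring r E \<phi>"
          obtain \<psi> where \<psi>: "edge_colouring r (complete_hypergraph t n) \<psi>" "strip_colouring r t n \<psi>"
            "real (mono_matching_number E \<phi>)
               \<ge> real (mono_matching_number (complete_hypergraph t n) \<psi>) - \<epsilon>' * real n"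
            using strip[rule_format, OF n EK nh \<phi>] by (elim exE conjE)
          have "\<epsilon>' * real n \<le> \<epsilon> * real n" using \<epsilon>'(3) by (intro mult_right_mono) auto
          then have "real (mono_matching_number E \<phi>)
              \<ge> real (mono_matching_number (complete_hypergraph t n) \<psi>) - \<epsilon> * real n"
            using \<psi>(3) by linarith
          then show "\<exists>\<psi>. edge_colouring r (complete_hypergraph t n) \<psi> \<and> strip_colouring r t n \<psi> \<and>
              real (mono_matching_number E \<phi>)
                \<ge> real (mono_matching_number (complete_hypergraph t n) \<psi>) - \<epsilon> * real n"
            using \<psi>(1,2) by (intro exI[of _ \<psi>] conjI)
        qed
      qed
      then have "?P n ((UNIV - hole n) \<inter> set_pmf (random_hypergraph t n (p n))) \<le> ?P n (G n)"
        by (intro measure_pmf.finite_measure_mono) auto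
      then show ?thesis
        using measure_pmf.prob_compl[of "hole n" "random_hypergraph t n (p n)"]
        by (simp add: measure_Int_set_pmf)
    qed
    then have lower: "\<forall>\<^sub>F n in sequentially. 1 - ?P n (hole n) \<le> ?P n (G n)"
      unfolding eventually_sequentially by blast
    have "(\<lambda>n. ?P n (hole n)) \<longlonglongrightarrow> 0"
      unfolding hole_def using p by (intro no_hole_whp[OF t \<theta> C _ large]) simp
    then have "(\<lambda>n. 1 - ?P n (hole n)) \<longlonglongrightarrow> 1 - 0" by (intro tendsto_diff tendsto_const)
    then have lim: "(\<lambda>n. 1 - ?P n (hole n)) \<longlonglongrightarrow> 1" by simp
    have "(\<lambda>n. ?P n (G n)) \<longlonglongrightarrow> 1"
      by (rule tendsto_sandwich[OF lower _ lim tendsto_const]) simp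
    then show "(\<lambda>n. measure_pmf.prob (random_hypergraph t n (p n))
                  {E. \<forall>\<phi>. edge_colouring r E \<phi> \<longrightarrow>
                        (\<exists>\<psi>. edge_colouring r (complete_hypergraph t n) \<psi> \<and>
                             strip_colouring r t n \<psi> \<and>
                             real (mono_matching_number E \<phi>)
                               \<ge> real (mono_matching_number (complete_hypergraph t n) \<psi>)
                                  - \<epsilon> * real n)})
             \<longlonglongrightarrow> 1"
      unfolding G_def .
  qed
qed

end
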